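(* For every stable assignment instance $(G,<,\mathbf{q})$ and every set $\overline A\subseteq A$ of consenting students, the output of Algorithm school-rotate-remove with consent coincides with the output of Kesten's EADAM (both described below) on the same input.
   Context: Setting: $G=(A\cup B,E)$ finite simple bipartite graph (students $A$, schools $B$); $<_v$ a strict total order on neighbours of each vertex $v$ (write $y>_x y'$, $y>_x\emptyset$ for each neighbour $y$); positive integer quotas $q_b$, and $q_a=1$ for $a\in A$. An assignment is $M\subseteq E$ with each vertex $v$ in at most $q_v$ edges; $M(x)=\{y:xy\in M\}$. Edge $ab$ blocks $M$ if $b>_a M(a)$ and either $|M(b)|<q_b$ or $a>_b a'$ for some $a'\in M(b)$; $M$ is stable if no edge blocks it. Student-proposing Gale–Shapley proceeds in steps: at each step, every student not currently temporarily accepted by any school and with schools left on his list not yet applied to applies to the most preferred such school; each school $b$ temporarily accepts its $q_b$ most preferred among the students it holds plus new applicants and rejects the rest; it stops when no student applies, outputting the temporarily accepted pairs (the student-optimal stable assignment). Student $a$ is an interrupter for school $b$ at step $k'$ ($ab$ an interrupting pair at step $k'$) if $a$ is temporarily accepted by $b$ at a step $k<k'$, rejected by $b$ at step $k'$, and some student is rejected by $b$ during steps $k,\dots,k'-1$. Kesten's EADAM: $G^0=G$; run Gale–Shapley on $(G^0,<,\mathbf{q})$; while the current run has an interrupter in $\overline A$: take the largest $k'$ with a consenting interrupter at step $k'$, delete all interrupting pairs $ab$ at step $k'$ with $a\in\overline A$, and re-run Gale–Shapley on the new graph; output the last assignment. School-rotation digraph: for stable $M$ and school $b$, $s_M(b)$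 is the most preferred student $a$ on $b$'s list (in the current instance) with $a\notin M(b)$ and $b>_a M(a)$ (may not exist); then $next_M(b)=M(a)$ ($\emptyset$ if unmatched). The digraph has vertices $A\cup B\cup\{\emptyset\}$ and arcs $(b,s_M(b)),(s_M(b),next_M(b))$. A directed cycle gives a school-rotation $\rho=a_0,b_0,\dots,a_{r-1},b_{r-1}$ ($b_ia_i\in M$, $s_M(b_i)=a_{i+1}$, mod $r$), and $M/\rho$ replaces each $b_ia_i$ by $b_ia_{i+1}$. School-rotate-remove with consent: $M^0$ = student-optimal stable assignment, $G^0=G$, $D^0$ its school-rotation digraph. While $D^i$ has an arc: find (i) arcs $(b',a),(a,b)$ with $b$ a sink of $D^i$, or (ii) a directed cycle (any choice allowed). In (i): remove $ab'$ to get $G^{i+1}$, keep $M^{i+1}=M^i$, and if $a\notin\overline A$ also remove all edges $a'b'$ with $a>_{b'}a'$. In (ii): $M^{i+1}=M^i/\rho^i$, $G^{i+1}=G^i$. Recompute $D^{i+1}$ in $(G^{i+1},<,\mathbf{q})$. Output $M^i$ when $D^i$ has no arc. *)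

theory Defs
  imports Main "HOL-Library.While_Combinator"
begin

text \<open>
  Students and schools live in two different types, so the two sides of the bipartite graph are
  disjoint by construction; an edge is a pair (student, school).  For a student \<open>a\<close>,
  \<open>lt_student I a y' y\<close> means that \<open>a\<close> strictly prefers the school \<open>y\<close> to \<open>y'\<close>, and
  likewise \<open>lt_school\<close> for schools.  The orders are only constrained on neighbours, so that the
  same orders serve for every subgraph arising in the algorithms.
\<close>

record ('a, 'b) assignment_instance =
  students :: "'a set"
  schools :: "'b set"
  edges :: "('a \<times> 'b) set"
  lt_student :: "'a \<Rightarrow> 'b \<Rightarrow> 'b \<Rightarrow> bool"
  lt_school :: "'b \<Rightarrow> 'a \<Rightarrow> 'a \<Rightarrow> bool"
  quota :: "'b \<Rightarrow> nat"

definition strict_total_order_on :: "'c set \<Rightarrow> ('c \<Rightarrow> 'c \<Rightarrow> bool) \<Rightarrow> bool" where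
  "strict_total_order_on S lt \<longleftrightarrow> irreflp_on S lt \<and> transp_on S lt \<and> totalp_on S lt"

definition stable_assignment_instance :: "('a, 'b) assignment_instance \<Rightarrow> bool" where
  "stable_assignment_instance I \<longleftrightarrow>
     finite (students I) \<and> finite (schools I) \<and> edges I \<subseteq> students I \<times> schools I \<and>
     (\<forall>a\<in>students I. strict_total_order_on (edges I `` {a}) (lt_student I a)) \<and>
     (\<forall>b\<in>schools I. strict_total_order_on ((edges I)\<inverse> `` {b}) (lt_school I b)) \<and>
     (\<forall>b\<in>schools I. 0 < quota I b)"

definition most_preferred :: "('c \<Rightarrow> 'c \<Rightarrow> bool) \<Rightarrow> 'c set \<Rightarrow> 'c \<Rightarrow> bool" where
  "most_preferred lt S x \<longleftrightarrow> x \<in> S \<and> (\<forall>y\<in>S. y \<noteq> x \<longrightarrow> lt y x)"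


section \<open>Stable assignments\<close>

text \<open>For an assignment \<open>M\<close>, the sets \<open>M(a)\<close> and \<open>M(b)\<close> are \<open>M `` {a}\<close> and \<open>M\<inverse> `` {b}\<close>.\<close>

definition assignment :: "('a, 'b) assignment_instance \<Rightarrow> ('a \<times> 'b) set \<Rightarrow> bool" where
  "assignment I M \<longleftrightarrow> M \<subseteq> edges I \<and>
     (\<forall>a\<in>students I. card (M `` {a}) \<le> 1) \<and>
     (\<forall>b\<in>schools I. card (M\<inverse> `` {b}) \<le> quota I b)"

text \<open>\<open>b >\<^sub>a M(a)\<close>; the condition is vacuous if \<open>a\<close> is unmatched.\<close>

definition prefers_to_assigned ::
    "('a, 'b) assignment_instance \<Rightarrow> ('a \<times> 'b) set \<Rightarrow> 'a \<Rightarrow> 'b \<Rightarrow> bool" where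
  "prefers_to_assigned I M a b \<longleftrightarrow> (\<forall>b'\<in>M `` {a}. lt_student I a b' b)"

definition blocks :: "('a, 'b) assignment_instance \<Rightarrow> ('a \<times> 'b) set \<Rightarrow> 'a \<Rightarrow> 'b \<Rightarrow> bool" where
  "blocks I M a b \<longleftrightarrow> (a, b) \<in> edges I \<and> prefers_to_assigned I M a b \<and>
     (card (M\<inverse> `` {b}) < quota I b \<or> (\<exists>a'\<in>M\<inverse> `` {b}. lt_school I b a' a))"

definition stable :: "('a, 'b) assignment_instance \<Rightarrow> ('a \<times> 'b) set \<Rightarrow> bool" where
  "stable I M \<longleftrightarrow> assignment I M \<and> (\<forall>a b. \<not> blocks I M a b)"

definition student_optimal_stable ::
    "('a, 'b) assignment_instance \<Rightarrow> ('a \<times> 'b) set \<Rightarrow> bool" where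
  "student_optimal_stable I M \<longleftrightarrow> stable I M \<and>
     (\<forall>N. stable I N \<longrightarrow>
        (\<forall>(a, b)\<in>N. \<exists>b'\<in>M `` {a}. b' = b \<or> lt_student I a b b'))"


section \<open>Student-proposing Gale--Shapley\<close>

text \<open>
  A state is a pair \<open>(P, H)\<close>: the applications made so far, and the temporarily accepted pairs.
\<close>

type_synonym ('a, 'b) gs_state = "('a \<times> 'b) set \<times> ('a \<times> 'b) set"

definition gs_applications ::
    "('a, 'b) assignment_instance \<Rightarrow> ('a, 'b) gs_state \<Rightarrow> ('a \<times> 'b) set" where
  "gs_applications I = (\<lambda>(P, H).
     {(a, b). H `` {a} = {} \<and> most_preferred (lt_student I a) (edges I `` {a} - P `` {a}) b})"

text \<open>
  An applicant in the pool of \<open>b\<close> is among its \<open>q\<^sub>b\<close> most preferred ones iff fewer than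
  \<open>q\<^sub>b\<close> members of the pool are preferred to it.
\<close>

definition gs_accept ::
    "('a, 'b) assignment_instance \<Rightarrow> ('a \<times> 'b) set \<Rightarrow> ('a \<times> 'b) set" where
  "gs_accept I X = {(a, b) \<in> X. card {a' \<in> X\<inverse> `` {b}. lt_school I b a a'} < quota I b}"

definition gs_step ::
    "('a, 'b) assignment_instance \<Rightarrow> ('a, 'b) gs_state \<Rightarrow> ('a, 'b) gs_state" where
  "gs_step I S = (fst S \<union> gs_applications I S, gs_accept I (snd S \<union> gs_applications I S))"

text \<open>
  \<open>gs I k\<close> is the state after step \<open>k\<close>; steps are numbered from 1.  Once no student applies,
  further steps change nothing and reject nobody, so the sequence may be continued forever.
\<close>

definition gs :: "('a, 'b) assignment_instance \<Rightarrow> nat \<Rightarrow> ('a, 'b) gs_state" where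
  "gs I k = (gs_step I ^^ k) ({}, {})"

abbreviation gs_held :: "('a, 'b) assignment_instance \<Rightarrow> nat \<Rightarrow> ('a \<times> 'b) set" where
  "gs_held I k \<equiv> snd (gs I k)"

fun gs_rejected :: "('a, 'b) assignment_instance \<Rightarrow> nat \<Rightarrow> ('a \<times> 'b) set" where
  "gs_rejected I 0 = {}"
| "gs_rejected I (Suc k) = (gs_held I k \<union> gs_applications I (gs I k)) - gs_held I (Suc k)"

definition gs_output :: "('a, 'b) assignment_instance \<Rightarrow> ('a \<times> 'b) set" where
  "gs_output I = gs_held I (LEAST n. gs_applications I (gs I n) = {})"


section \<open>Kesten's EADAM\<close>

definition interrupting_pairs ::
    "('a, 'b) assignment_instance \<Rightarrow> nat \<Rightarrow> ('a \<times> 'b) set" where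
  "interrupting_pairs I k' = {(a, b). (a, b) \<in> gs_rejected I k' \<and>
     (\<exists>k<k'. (a, b) \<in> gs_held I k \<and> (\<exists>j\<in>{k..<k'}. \<exists>a'. (a', b) \<in> gs_rejected I j))}"

definition consenting_pairs ::
    "'a set \<Rightarrow> ('a, 'b) assignment_instance \<Rightarrow> nat \<Rightarrow> ('a \<times> 'b) set" where
  "consenting_pairs C I k' = {(a, b) \<in> interrupting_pairs I k'. a \<in> C}"

definition eadam_continue :: "'a set \<Rightarrow> ('a, 'b) assignment_instance \<Rightarrow> bool" where
  "eadam_continue C I \<longleftrightarrow> (\<exists>k'. consenting_pairs C I k' \<noteq> {})"

definition eadam_step ::
    "'a set \<Rightarrow> ('a, 'b) assignment_instance \<Rightarrow> ('a, 'b) assignment_instance" where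
  "eadam_step C I =
     I\<lparr>edges := edges I - consenting_pairs C I (Max {k'. consenting_pairs C I k' \<noteq> {}})\<rparr>"

definition eadam :: "'a set \<Rightarrow> ('a, 'b) assignment_instance \<Rightarrow> ('a \<times> 'b) set" where
  "eadam C I = gs_output (while (eadam_continue C) (eadam_step C) I)"


section \<open>School-rotate-remove with consent\<close>

datatype ('a, 'b) vertex = Student 'a | School 'b | Unmatched

text \<open>\<open>is_s I M b a\<close> says that \<open>s\<^sub>M(b)\<close> exists and equals \<open>a\<close>.\<close>

definition is_s ::
    "('a, 'b) assignment_instance \<Rightarrow> ('a \<times> 'b) set \<Rightarrow> 'b \<Rightarrow> 'a \<Rightarrow> bool" where
  "is_s I M b a \<longleftrightarrow> most_preferred (lt_school I b)
     {a \<in> (edges I)\<inverse> `` {b}. a \<notin> M\<inverse> `` {b} \<and> prefers_to_assigned I M a b} a"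

text \<open>The arc set; the vertex \<open>\<emptyset>\<close> of the digraph is \<open>Unmatched\<close>.\<close>

definition school_rotation_digraph ::
    "('a, 'b) assignment_instance \<Rightarrow> ('a \<times> 'b) set \<Rightarrow>
      (('a, 'b) vertex \<times> ('a, 'b) vertex) set" where
  "school_rotation_digraph I M =
     {(School b, Student a) | a b. is_s I M b a} \<union>
     {(Student a, School b') | a b'. (\<exists>b. is_s I M b a) \<and> b' \<in> M `` {a}} \<union>
     {(Student a, Unmatched) | a. (\<exists>b. is_s I M b a) \<and> M `` {a} = {}}"

text \<open>
  The directed cycle \<open>a\<^sub>0, b\<^sub>0, \<dots>, a\<^bsub>r-1\<^esub>, b\<^bsub>r-1\<^esub>\<close> is the list of the pairs \<open>(a\<^sub>i, b\<^sub>i)\<close>.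
\<close>

definition school_rotation ::
    "('a, 'b) assignment_instance \<Rightarrow> ('a \<times> 'b) set \<Rightarrow> ('a \<times> 'b) list \<Rightarrow> bool" where
  "school_rotation I M \<rho> \<longleftrightarrow>
     \<rho> \<noteq> [] \<and> distinct (map fst \<rho>) \<and> distinct (map snd \<rho>) \<and>
     (\<forall>i<length \<rho>.
        (Student (fst (\<rho> ! i)), School (snd (\<rho> ! i))) \<in> school_rotation_digraph I M \<and>
        (School (snd (\<rho> ! i)), Student (fst (\<rho> ! (Suc i mod length \<rho>))))
          \<in> school_rotation_digraph I M)"

definition apply_rotation ::
    "('a \<times> 'b) set \<Rightarrow> ('a \<times> 'b) list \<Rightarrow> ('a \<times> 'b) set" where
  "apply_rotation M \<rho> =
     (M - set \<rho>) \<union> {(fst (\<rho> ! (Suc i mod length \<rho>)), snd (\<rho> ! i)) | i. i < length \<rho>}"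

definition removed_edges ::
    "'a set \<Rightarrow> ('a, 'b) assignment_instance \<Rightarrow> 'a \<Rightarrow> 'b \<Rightarrow> ('a \<times> 'b) set" where
  "removed_edges C I a b' =
     {(a, b')} \<union> (if a \<in> C then {} else {(a', b') | a'. lt_school I b' a' a})"

text \<open>
  One iteration, as a relation because the choice among the cases (i) and (ii), and within each
  of them, is free.  In (i) the sink \<open>v\<close> is a school or \<open>Unmatched\<close>.
\<close>

inductive srr_step ::
    "'a set \<Rightarrow> ('a, 'b) assignment_instance \<times> ('a \<times> 'b) set \<Rightarrow>
      ('a, 'b) assignment_instance \<times> ('a \<times> 'b) set \<Rightarrow> bool"
  for C :: "'a set" where
  srr_remove:
    "\<lbrakk>(School b', Student a) \<in> school_rotation_digraph I M;
      (Student a, v) \<in> school_rotation_digraph I M;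
      v \<notin> Domain (school_rotation_digraph I M)\<rbrakk>
     \<Longrightarrow> srr_step C (I, M) (I\<lparr>edges := edges I - removed_edges C I a b'\<rparr>, M)"
| srr_rotate:
    "school_rotation I M \<rho> \<Longrightarrow> srr_step C (I, M) (I, apply_rotation M \<rho>)"

definition srr_reachable ::
    "'a set \<Rightarrow> ('a, 'b) assignment_instance \<Rightarrow>
      ('a, 'b) assignment_instance \<times> ('a \<times> 'b) set \<Rightarrow> bool" where
  "srr_reachable C I S \<longleftrightarrow>
     (\<exists>M0. student_optimal_stable I M0 \<and> (srr_step C)\<^sup>*\<^sup>* (I, M0) S)"

definition srr_output ::
    "'a set \<Rightarrow> ('a, 'b) assignment_instance \<Rightarrow> ('a \<times> 'b) set \<Rightarrow> bool" where
  "srr_output C I M \<longleftrightarrow>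
     (\<exists>J. srr_reachable C I (J, M) \<and> school_rotation_digraph J M = {})"

text \<open>
  Whatever choices are made, the algorithm never gets stuck while the digraph has an arc, and it
  does not run forever.
\<close>

definition srr_terminates :: "'a set \<Rightarrow> ('a, 'b) assignment_instance \<Rightarrow> bool" where
  "srr_terminates C I \<longleftrightarrow>
     (\<forall>J M. srr_reachable C I (J, M) \<and> school_rotation_digraph J M \<noteq> {} \<longrightarrow>
        (\<exists>S'. srr_step C (J, M) S')) \<and>
     \<not> (\<exists>f. srr_reachable C I (f 0) \<and> (\<forall>i::nat. srr_step C (f i) (f (Suc i))))"


section \<open>Termination of Gale--Shapley and EADAM\<close>

text \<open>
  These facts show that \<open>LEAST\<close>, \<open>Max\<close> and \<open>while\<close> above are applied only where they
  have their intended meaning.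
\<close>

lemma gs_applications_subset: "gs_applications I S \<subseteq> edges I - fst S"
  by (auto simp: gs_applications_def most_preferred_def split: prod.splits)

lemma gs_Suc: "gs I (Suc k) = gs_step I (gs I k)"
  by (simp add: gs_def)

lemma gs_subset: "fst (gs I k) \<subseteq> edges I \<and> snd (gs I k) \<subseteq> edges I"
proof (induction k)
  case 0
  then show ?case by (simp add: gs_def)
next
  case (Suc k)
  then show ?case
    using gs_applications_subset[of I "gs I k"]
    by (auto simp: gs_Suc gs_step_def gs_accept_def)
qed

lemma gs_terminates:
  assumes "finite (edges I)"
  shows "\<exists>n. gs_applications I (gs I n) = {}"
proof (rule ccontr)
  assume "\<nexists>n. gs_applications I (gs I n) = {}"
  then have ne: "gs_applications I (gs I n) \<noteq> {}" for n by blast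
  have "n \<le> card (fst (gs I n))" for n
  proof (induction n)
    case 0
    then show ?case by simp
  next
    case (Suc n)
    have "fst (gs I n) \<subset> fst (gs I (Suc n))"
      using ne[of n] gs_applications_subset[of I "gs I n"] by (auto simp: gs_Suc gs_step_def)
    moreover have "finite (fst (gs I (Suc n)))"
      by (rule finite_subset[OF _ assms]) (simp only: gs_subset)
    ultimately have "card (fst (gs I n)) < card (fst (gs I (Suc n)))"
      by (rule psubset_card_mono[rotated])
    then show ?case using Suc by simp
  qed
  from this[of "Suc (card (edges I))"]
  have "Suc (card (edges I)) \<le> card (fst (gs I (Suc (card (edges I)))))" .
  also have "\<dots> \<le> card (edges I)"
    by (rule card_mono[OF assms]) (simp only: gs_subset)
  finally show False by simp
qed

lemma gs_accept_idem:
  assumes "finite X"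
  shows "gs_accept I (gs_accept I X) = gs_accept I X"
proof -
  have "card {a' \<in> (gs_accept I X)\<inverse> `` {b}. lt_school I b a a'}
      \<le> card {a' \<in> X\<inverse> `` {b}. lt_school I b a a'}" for a b
  proof (rule card_mono)
    have "X\<inverse> `` {b} \<subseteq> fst ` X" by force
    then show "finite {a' \<in> X\<inverse> `` {b}. lt_school I b a a'}"
      by (intro finite_subset[OF _ finite_imageI[OF assms, of fst]]) blast
  qed (auto simp: gs_accept_def)
  then show ?thesis
    unfolding gs_accept_def[of I "gs_accept I X"]
    by (auto simp: gs_accept_def intro: le_less_trans)
qed

lemma gs_stationary:
  assumes "finite (edges I)" and "gs_applications I (gs I n) = {}" and "n \<le> k"
  shows "gs I k = gs I n"
proof -
  have acc: "gs_accept I (snd (gs I n)) = snd (gs I n)"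
  proof (cases n)
    case 0
    then show ?thesis by (simp add: gs_def gs_accept_def)
  next
    case (Suc m)
    have "finite (snd (gs I m) \<union> gs_applications I (gs I m))"
      using gs_subset[of I m] gs_applications_subset[of I "gs I m"]
      by (intro finite_subset[OF _ assms(1)]) blast
    then show ?thesis
      using Suc by (simp add: gs_Suc gs_step_def gs_accept_idem)
  qed
  show ?thesis
    using assms(3)
  proof (induction k rule: dec_induct)
    case base
    then show ?case by simp
  next
    case (step k)
    have "gs I (Suc k) = gs_step I (gs I n)"
      using step by (simp add: gs_Suc)
    also have "\<dots> = gs I n"
      using assms(2) acc by (simp add: gs_step_def)
    finally show ?case .
  qed
qed

lemma gs_rejected_bound:
  assumes "finite (edges I)" and "gs_applications I (gs I n) = {}" and "n < k"
  shows "gs_rejected I k = {}"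
proof -
  obtain m where m: "k = Suc m" "n \<le> m" using assms(3) by (cases k) auto
  then show ?thesis
    using gs_stationary[OF assms(1,2), of m] gs_stationary[OF assms(1,2), of "Suc m"] assms(2)
    by simp
qed

lemma finite_interrupting_steps:
  assumes "finite (edges I)"
  shows "finite {k'. consenting_pairs C I k' \<noteq> {}}"
proof -
  obtain n where n: "gs_applications I (gs I n) = {}" using gs_terminates[OF assms] by blast
  have "{k'. consenting_pairs C I k' \<noteq> {}} \<subseteq> {..n}"
    using gs_rejected_bound[OF assms n]
    by (force simp: consenting_pairs_def interrupting_pairs_def not_less[symmetric])
  then show ?thesis using finite_subset by blast
qed

lemma eadam_terminates:
  assumes "finite (edges I)"
  shows "\<exists>J. while_option (eadam_continue C) (eadam_step C) I = Some J"
proof (rule measure_while_option_Some[where P = "\<lambda>J. finite (edges J)" and f = "\<lambda>J. card (edges J)",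
      THEN exE])
  fix J :: "('a, 'b) assignment_instance"
  assume J: "finite (edges J)" "eadam_continue C J"
  define k where "k = Max {k'. consenting_pairs C J k' \<noteq> {}}"
  have "k \<in> {k'. consenting_pairs C J k' \<noteq> {}}"
    unfolding k_def using J finite_interrupting_steps
    by (intro Max_in) (auto simp: eadam_continue_def)
  moreover have "consenting_pairs C J k \<subseteq> edges J"
    using gs_subset[of J] by (fastforce simp: consenting_pairs_def interrupting_pairs_def)
  ultimately have "edges (eadam_step C J) \<subset> edges J"
    by (auto simp: eadam_step_def k_def[symmetric])
  then show "finite (edges (eadam_step C J)) \<and> card (edges (eadam_step C J)) < card (edges J)"
    using J(1) by (auto intro: psubset_card_mono finite_subset)
qed (use assms in auto)

end

theory Submission
  imports Defs "HOL-Library.Confluence"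
begin

text \<open>
  Two different iterations of school-rotate-remove at the same state commute, since every vertex of
  the digraph has at most one outgoing arc and sinks stay sinks; hence the algorithm is confluent
  and its result is constant along its runs.  Rotations alone lead from any stable assignment to the
  student-optimal one.  Let \<open>S\<close> be the set of pairs deleted by one round of EADAM: removals alone,
  applied to the student-optimal assignment \<open>M\<close> for as long as possible, delete all of \<open>S\<close>, and
  the same removals can be replayed from \<open>G - S\<close>.  So \<open>(G, M)\<close> and \<open>(G - S, M)\<close>, and therefore
  also \<open>G - S\<close> with its own student-optimal assignment, have the same result.  When no consenting
  interrupter is left, deleting pairs of consenting envious students does not change the
  student-optimal assignment, so no rotation ever appears and the result is the output of
  Gale--Shapley.
\<close>

section \<open>Strict total orders\<close>

text \<open>EADAM inspects the time steps of a run, school-rotate-remove a digraph attached to an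
  assignment. The translation between them is the set \<open>envy I M\<close> of pairs
  \<open>(a, b)\<close> such that \<open>a\<close> would rather be at \<open>b\<close>. Besides
  \<open>M\<close> and the school orders, the arcs depend only on this set. Deleting edges subtracts
  them from it, a rotation shrinks it, and at the output of Gale--Shapley it consists of exactly the
  pairs refused at some step of the run.

  A step-by-step simulation is obstructed twice: EADAM deletes the pairs of its last interrupting
  step at once, while a removal must wait for a sink; and a removal without consent also clears all
  lower edges of the school, which has no counterpart in EADAM. Therefore only final results are
  compared. The delicate point is that the pairs deleted by EADAM are never missed by exhaustive
  removal: this uses that the step is the last one with a consenting interrupter, and that at a
  school still envied only consenting students have lost edges.\<close>

lemma strict_total_order_on_subset:
  assumes "strict_total_order_on T lt" and "S \<subseteq> T"
  shows "strict_total_order_on S lt"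
  using assms unfolding strict_total_order_on_def
  by (meson irreflp_on_subset transp_on_subset totalp_on_subset)

lemma strict_total_order_onD:
  assumes "strict_total_order_on S lt"
  shows "x \<in> S \<Longrightarrow> \<not> lt x x"
    and "x \<in> S \<Longrightarrow> y \<in> S \<Longrightarrow> z \<in> S \<Longrightarrow> lt x y \<Longrightarrow> lt y z \<Longrightarrow> lt x z"
    and "x \<in> S \<Longrightarrow> y \<in> S \<Longrightarrow> x \<noteq> y \<Longrightarrow> lt x y \<or> lt y x"
  using assms unfolding strict_total_order_on_def
  by (auto dest: irreflp_onD transp_onD totalp_onD)

lemma strict_total_order_on_converse:
  assumes "strict_total_order_on S lt"
  shows "strict_total_order_on S (\<lambda>x y. lt y x)"
  unfolding strict_total_order_on_def
proof (intro conjI)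
  show "irreflp_on S (\<lambda>x y. lt y x)"
    using strict_total_order_onD(1)[OF assms] by (intro irreflp_onI)
  show "transp_on S (\<lambda>x y. lt y x)"
    using strict_total_order_onD(2)[OF assms] by (intro transp_onI) blast
  show "totalp_on S (\<lambda>x y. lt y x)"
    using strict_total_order_onD(3)[OF assms] by (intro totalp_onI) blast
qed

lemma most_preferred_exists:
  assumes "strict_total_order_on S lt" and "finite S" and "S \<noteq> {}"
  obtains m where "most_preferred lt S m"
proof -
  have "asymp_on S lt"
  proof (rule asymp_onI)
    show "\<not> lt y x" if "x \<in> S" "y \<in> S" "lt x y" for x y
      using strict_total_order_onD(1)[OF assms(1), of x]
        strict_total_order_onD(2)[OF assms(1), of x y x] that by blast
  qed
  moreover have "transp_on S lt"
    using assms(1) by (simp add: strict_total_order_on_def)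
  ultimately obtain m where "m \<in> S" "\<forall>x\<in>S. x \<noteq> m \<longrightarrow> \<not> lt m x"
    using Finite_Set.bex_max_element[of S lt] assms(2,3) by blast
  then show ?thesis
    using strict_total_order_onD(3)[OF assms(1)]
    by (intro that[of m]) (auto simp: most_preferred_def)
qed

lemma most_preferred_unique:
  assumes "strict_total_order_on S lt" and "most_preferred lt S x" and "most_preferred lt S y"
  shows "x = y"
proof (rule ccontr)
  assume "x \<noteq> y"
  then have "x \<in> S" "y \<in> S" "lt x y" "lt y x"
    using assms(2,3) by (auto simp: most_preferred_def)
  then show False
    using strict_total_order_onD(1)[OF assms(1), of x]
      strict_total_order_onD(2)[OF assms(1), of x y x] by blast
qed

section \<open>The q most preferred members of a finite totally ordered set\<close>

context
  fixes S T :: "'c set" and lt :: "'c \<Rightarrow> 'c \<Rightarrow> bool" and q :: nat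
  assumes order: "strict_total_order_on S lt" and fin: "finite S"
    and T: "T = {a \<in> S. card {a' \<in> S. lt a a'} < q}"
begin

text \<open>The least preferred member of \<open>T\<close> is beaten by all its other members, and
  by fewer than \<open>q\<close> elements altogether.\<close>

lemma top_card_le: "card T \<le> q"
proof (cases "T = {}")
  case False
  have "T \<subseteq> S" using T by blast
  then have "strict_total_order_on T (\<lambda>x y. lt y x)"
    using order strict_total_order_on_converse strict_total_order_on_subset by blast
  then obtain m where m: "most_preferred (\<lambda>x y. lt y x) T m"
    using most_preferred_exists False finite_subset[OF \<open>T \<subseteq> S\<close> fin] by blast
  then have "T \<subseteq> insert m {a' \<in> S. lt m a'}"
    using \<open>T \<subseteq> S\<close> by (auto simp: most_preferred_def)
  then have "card T \<le> card (insert m {a' \<in> S. lt m a'})"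
    using fin by (intro card_mono) auto
  also have "\<dots> \<le> Suc (card {a' \<in> S. lt m a'})"
    using fin by (simp add: card_insert_if)
  finally show ?thesis using m T by (auto simp: most_preferred_def)
qed simp

lemma top_upward_closed: "a \<in> T \<Longrightarrow> c \<in> S \<Longrightarrow> lt a c \<Longrightarrow> c \<in> T"
proof -
  assume a: "a \<in> T" and c: "c \<in> S" "lt a c"
  then have "{a' \<in> S. lt c a'} \<subseteq> {a' \<in> S. lt a a'}"
    using strict_total_order_onD(2)[OF order] T by blast
  then have "card {a' \<in> S. lt c a'} \<le> card {a' \<in> S. lt a a'}"
    using fin by (intro card_mono) auto
  then show "c \<in> T" using a c T by auto
qed

lemma top_better: "a \<in> S \<Longrightarrow> a \<notin> T \<Longrightarrow> t \<in> T \<Longrightarrow> lt a t"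
  using top_upward_closed strict_total_order_onD(3)[OF order, of a t] T by blast

text \<open>The best outsider is beaten only by members of \<open>T\<close>, and being outside it is
  beaten by at least \<open>q\<close> elements.\<close>

lemma top_card_eq:
  assumes "a \<in> S" "a \<notin> T"
  shows "card T = q"
proof -
  have "strict_total_order_on (S - T) lt"
    using order strict_total_order_on_subset by blast
  then obtain m where m: "most_preferred lt (S - T) m"
    using most_preferred_exists[of "S - T" lt] assms fin by blast
  have "lt c m" if "c \<in> S - T" "c \<noteq> m" for c
    using m that by (simp add: most_preferred_def)
  moreover have "\<not> (lt m c \<and> lt c m)" "\<not> lt m m" if "c \<in> S" for c
    using strict_total_order_onD(1)[OF order, of m] strict_total_order_onD(2)[OF order, of m c m]
      m that unfolding most_preferred_def by blast+
  ultimately have "{a' \<in> S. lt m a'} \<subseteq> T" by blast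
  then have "card {a' \<in> S. lt m a'} \<le> card T"
    using fin T by (intro card_mono) auto
  moreover have "q \<le> card {a' \<in> S. lt m a'}"
    using m T by (auto simp: most_preferred_def)
  ultimately show ?thesis using top_card_le by simp
qed

end

section \<open>Preference orders of an instance, stated for edges\<close>

lemma instance_finite_edges:
  "stable_assignment_instance I \<Longrightarrow> finite (edges I)"
  unfolding stable_assignment_instance_def by (meson finite_SigmaI finite_subset)

lemma student_order:
  assumes "stable_assignment_instance I"
  shows "strict_total_order_on (edges I `` {a}) (lt_student I a)"
proof (cases "a \<in> students I")
  case True
  then show ?thesis using assms by (auto simp: stable_assignment_instance_def)
next
  case False
  then have "edges I `` {a} = {}" using assms by (auto simp: stable_assignment_instance_def)
  then show ?thesis
    by (simp add: strict_total_order_on_def irreflp_on_def transp_on_def)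
qed

lemma school_order:
  assumes "stable_assignment_instance I"
  shows "strict_total_order_on ((edges I)\<inverse> `` {b}) (lt_school I b)"
proof (cases "b \<in> schools I")
  case True
  then show ?thesis using assms by (auto simp: stable_assignment_instance_def)
next
  case False
  then have "(edges I)\<inverse> `` {b} = {}" using assms by (auto simp: stable_assignment_instance_def)
  then show ?thesis by (simp only:) (simp add: strict_total_order_on_def irreflp_on_def transp_on_def)
qed

lemma student_irrefl:
  "stable_assignment_instance I \<Longrightarrow> (a, b) \<in> edges I \<Longrightarrow> \<not> lt_student I a b b"
  using strict_total_order_onD(1)[OF student_order] by fast

lemma student_trans:
  "stable_assignment_instance I \<Longrightarrow> (a, b) \<in> edges I \<Longrightarrow> (a, c) \<in> edges I \<Longrightarrow> (a, d) \<in> edges I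
    \<Longrightarrow> lt_student I a b c \<Longrightarrow> lt_student I a c d \<Longrightarrow> lt_student I a b d"
  using strict_total_order_onD(2)[OF student_order, of I b a c d] by simp

lemma student_total:
  "stable_assignment_instance I \<Longrightarrow> (a, b) \<in> edges I \<Longrightarrow> (a, c) \<in> edges I \<Longrightarrow> b \<noteq> c
    \<Longrightarrow> lt_student I a b c \<or> lt_student I a c b"
  using strict_total_order_onD(3)[OF student_order, of I b a c] by simp

lemma school_irrefl:
  "stable_assignment_instance I \<Longrightarrow> (a, b) \<in> edges I \<Longrightarrow> \<not> lt_school I b a a"
  using strict_total_order_onD(1)[OF school_order, of I a b] by simp

lemma school_trans:
  "stable_assignment_instance I \<Longrightarrow> (a, b) \<in> edges I \<Longrightarrow> (c, b) \<in> edges I \<Longrightarrow> (d, b) \<in> edges I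
    \<Longrightarrow> lt_school I b a c \<Longrightarrow> lt_school I b c d \<Longrightarrow> lt_school I b a d"
  using strict_total_order_onD(2)[OF school_order, of I a b c d] by simp

lemma school_total:
  "stable_assignment_instance I \<Longrightarrow> (a, b) \<in> edges I \<Longrightarrow> (c, b) \<in> edges I \<Longrightarrow> a \<noteq> c
    \<Longrightarrow> lt_school I b a c \<or> lt_school I b c a"
  using strict_total_order_onD(3)[OF school_order, of I a b c] by simp

lemma student_asym:
  "stable_assignment_instance I \<Longrightarrow> (a, b) \<in> edges I \<Longrightarrow> (a, c) \<in> edges I
    \<Longrightarrow> lt_student I a b c \<Longrightarrow> \<not> lt_student I a c b"
  using student_irrefl[of I a b] student_trans[of I a b c b] by blast

lemma school_asym:
  "stable_assignment_instance I \<Longrightarrow> (a, b) \<in> edges I \<Longrightarrow> (c, b) \<in> edges I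
    \<Longrightarrow> lt_school I b a c \<Longrightarrow> \<not> lt_school I b c a"
  using school_irrefl[of I a b] school_trans[of I a b c a] by blast

lemma finite_students_of: "finite X \<Longrightarrow> finite (X\<inverse> `` {b})"
  by (rule finite_subset[of _ "fst ` X"]) force+

lemma finite_schools_of: "finite X \<Longrightarrow> finite (X `` {a})"
  by (rule finite_subset[of _ "snd ` X"]) force+

lemma instance_delete_edges:
  assumes "stable_assignment_instance I"
  shows "stable_assignment_instance (I\<lparr>edges := edges I - X\<rparr>)"
proof -
  have "strict_total_order_on ((edges I - X) `` {a}) (lt_student I a)" for a
    by (rule strict_total_order_on_subset[OF student_order[OF assms]]) blast
  moreover have "strict_total_order_on ((edges I - X)\<inverse> `` {b}) (lt_school I b)" for b
    by (rule strict_total_order_on_subset[OF school_order[OF assms]]) blast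
  ultimately show ?thesis
    using assms by (auto simp: stable_assignment_instance_def)
qed

section \<open>The Gale--Shapley run\<close>

context
  fixes I :: "('a, 'b) assignment_instance" and X :: "('a \<times> 'b) set"
  assumes inst: "stable_assignment_instance I" and sub: "X \<subseteq> edges I"
begin

lemma pool_order: "strict_total_order_on (X\<inverse> `` {b}) (lt_school I b)"
  by (rule strict_total_order_on_subset[OF school_order[OF inst]]) (use sub in blast)

lemma pool_finite: "finite (X\<inverse> `` {b})"
  using finite_students_of finite_subset[OF sub instance_finite_edges[OF inst]] .

lemma gs_accept_Image:
  "(gs_accept I X)\<inverse> `` {b}
     = {a \<in> X\<inverse> `` {b}. card {a' \<in> X\<inverse> `` {b}. lt_school I b a a'} < quota I b}"
  by (auto simp: gs_accept_def)

lemmas gs_accept_card_le = top_card_le[OF pool_order pool_finite gs_accept_Image]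

lemma gs_accept_card_eq:
  "(a, b) \<in> X \<Longrightarrow> (a, b) \<notin> gs_accept I X \<Longrightarrow> card ((gs_accept I X)\<inverse> `` {b}) = quota I b"
  using top_card_eq[OF pool_order pool_finite gs_accept_Image, of a b] by simp

lemma gs_accept_better:
  "(a, b) \<in> X \<Longrightarrow> (a, b) \<notin> gs_accept I X \<Longrightarrow> (t, b) \<in> gs_accept I X \<Longrightarrow> lt_school I b a t"
  using top_better[OF pool_order pool_finite gs_accept_Image, of a b t] by simp

end

lemma gs_accept_subset: "gs_accept I X \<subseteq> X"
  by (auto simp: gs_accept_def)

text \<open>Path independence of choosing the best up to the quota: discarding rejected applicants
  early does not alter later choices.\<close>

lemma gs_accept_Un:
  assumes inst: "stable_assignment_instance I" and sub: "X \<union> Y \<subseteq> edges I"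
  shows "gs_accept I (gs_accept I X \<union> Y) = gs_accept I (X \<union> Y)"
proof -
  let ?A = "gs_accept I X"
  have subX: "X \<subseteq> edges I" using sub by blast
  have fin: "finite {a' \<in> V\<inverse> `` {b}. lt_school I b a a'}" if "V \<subseteq> edges I" for V a b
    using pool_finite[OF inst that, of b] by (rule finite_subset[rotated]) blast
  have mono: "card {a' \<in> U\<inverse> `` {b}. lt_school I b a a'} \<le> card {a' \<in> V\<inverse> `` {b}. lt_school I b a a'}"
    if "U \<subseteq> V" "V \<subseteq> edges I" for U V a b
    by (rule card_mono[OF fin[OF that(2)]]) (use that in auto)
  have subAY: "?A \<union> Y \<subseteq> edges I" using sub gs_accept_subset[of I X] by blast
  have "(a, b) \<in> gs_accept I (?A \<union> Y) \<longleftrightarrow> (a, b) \<in> gs_accept I (X \<union> Y)" for a b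
  proof
    assume L: "(a, b) \<in> gs_accept I (X \<union> Y)"
    have "card {a' \<in> X\<inverse> `` {b}. lt_school I b a a'} < quota I b"
      using L mono[of X "X \<union> Y" b a] sub by (auto simp: gs_accept_def)
    then have "(a, b) \<in> ?A \<union> Y" using L by (auto simp: gs_accept_def)
    moreover have "card {a' \<in> (?A \<union> Y)\<inverse> `` {b}. lt_school I b a a'} < quota I b"
    proof (rule le_less_trans[OF mono])
      show "card {a' \<in> (X \<union> Y)\<inverse> `` {b}. lt_school I b a a'} < quota I b"
        using L by (simp add: gs_accept_def)
    qed (use sub gs_accept_subset[of I X] in blast)+
    ultimately show "(a, b) \<in> gs_accept I (?A \<union> Y)" by (auto simp: gs_accept_def[of I "?A \<union> Y"])
  next
    assume R: "(a, b) \<in> gs_accept I (?A \<union> Y)"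
    then have aAY: "(a, b) \<in> ?A \<union> Y"
      and less: "card {a' \<in> (?A \<union> Y)\<inverse> `` {b}. lt_school I b a a'} < quota I b"
      by (auto simp: gs_accept_def[of I "?A \<union> Y"])
    have aE: "(a, b) \<in> edges I" using aAY sub gs_accept_subset[of I X] by blast
    have "{a' \<in> (X \<union> Y)\<inverse> `` {b}. lt_school I b a a'}
        \<subseteq> {a' \<in> (?A \<union> Y)\<inverse> `` {b}. lt_school I b a a'}"
    proof (rule ccontr)
      assume "\<not> ?thesis"
      \<comment> \<open>Such a \<open>z\<close> was discarded from a full set of holders, all above
        \<open>z\<close> and hence above \<open>a\<close>; then \<open>a\<close> has at least
        \<open>quota I b\<close> betters in the smaller pool already.\<close>
      then obtain z where z: "(z, b) \<in> X" "(z, b) \<notin> ?A" "lt_school I b a z" by blast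
      have "?A\<inverse> `` {b} \<subseteq> {a' \<in> (?A \<union> Y)\<inverse> `` {b}. lt_school I b a a'}"
      proof
        fix t assume "t \<in> ?A\<inverse> `` {b}"
        then have t: "(t, b) \<in> ?A" by simp
        then have "lt_school I b z t" using gs_accept_better[OF inst subX z(1,2)] by blast
        moreover have "(t, b) \<in> edges I" "(z, b) \<in> edges I"
          using t z subX gs_accept_subset[of I X] by blast+
        ultimately have "lt_school I b a t" using school_trans[OF inst aE] z(3) by blast
        then show "t \<in> {a' \<in> (?A \<union> Y)\<inverse> `` {b}. lt_school I b a a'}" using t by simp
      qed
      then have "card (?A\<inverse> `` {b}) \<le> card {a' \<in> (?A \<union> Y)\<inverse> `` {b}. lt_school I b a a'}"
        by (rule card_mono[OF fin[OF subAY]])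
      then show False using less gs_accept_card_eq[OF inst subX z(1,2)] by simp
    qed
    then have "card {a' \<in> (X \<union> Y)\<inverse> `` {b}. lt_school I b a a'} < quota I b"
      using card_mono[OF fin[OF subAY]] less le_less_trans by blast
    then show "(a, b) \<in> gs_accept I (X \<union> Y)"
      using aAY gs_accept_subset[of I X] by (auto simp: gs_accept_def[of I "X \<union> Y"])
  qed
  then show ?thesis by auto
qed

section \<open>The run described by all applications and refusals so far\<close>

definition gs_refused :: "('a, 'b) assignment_instance \<Rightarrow> nat \<Rightarrow> ('a \<times> 'b) set" where
  "gs_refused I k = fst (gs I k) - gs_held I k"

text \<open>The candidates for \<open>is_s\<close> at all schools at once; as one set of pairs they
  can be compared by inclusion between instances and assignments.\<close>

definition envy :: "('a, 'b) assignment_instance \<Rightarrow> ('a \<times> 'b) set \<Rightarrow> ('a \<times> 'b) set" where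
  "envy I M = {(a, b) \<in> edges I. (a, b) \<notin> M \<and> prefers_to_assigned I M a b}"

lemma gs_0: "gs I 0 = ({}, {})"
  by (simp add: gs_def)

lemma gs_applications_iff:
  "(a, b) \<in> gs_applications I (gs I k) \<longleftrightarrow> gs_held I k `` {a} = {} \<and>
     most_preferred (lt_student I a) (edges I `` {a} - fst (gs I k) `` {a}) b"
  by (simp add: gs_applications_def split: prod.splits)

lemma gs_applied_Suc: "fst (gs I (Suc k)) = fst (gs I k) \<union> gs_applications I (gs I k)"
  by (simp add: gs_Suc gs_step_def)

lemma gs_applied_mono: "j \<le> k \<Longrightarrow> fst (gs I j) \<subseteq> fst (gs I k)"
  by (rule lift_Suc_mono_le[of "\<lambda>k. fst (gs I k)"]) (auto simp: gs_applied_Suc)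

lemma gs_held_Suc_subset: "gs_held I (Suc k) \<subseteq> gs_held I k \<union> gs_applications I (gs I k)"
  using gs_accept_subset by (simp add: gs_Suc gs_step_def)

context
  fixes I :: "('a, 'b) assignment_instance"
  assumes inst: "stable_assignment_instance I"
begin

text \<open>By path independence a school holds the best among all who ever applied to it, so the
  facts about \<open>gs_accept\<close> apply at every moment of the run.\<close>

lemma gs_held_eq_accept: "gs_held I k = gs_accept I (fst (gs I k))"
proof (induction k)
  case 0
  then show ?case by (simp add: gs_0 gs_accept_def)
next
  case (Suc k)
  have "gs_held I (Suc k) = gs_accept I (gs_accept I (fst (gs I k)) \<union> gs_applications I (gs I k))"
    using Suc by (simp add: gs_Suc gs_step_def)
  also have "\<dots> = gs_accept I (fst (gs I k) \<union> gs_applications I (gs I k))"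
    using gs_subset[of I k] gs_applications_subset[of I "gs I k"]
    by (intro gs_accept_Un[OF inst]) blast
  finally show ?case by (simp add: gs_applied_Suc)
qed

lemma gs_held_applied: "gs_held I k \<subseteq> fst (gs I k)"
  using gs_accept_subset gs_held_eq_accept by blast

lemma gs_held_card_le: "card ((gs_held I k)\<inverse> `` {b}) \<le> quota I b"
  using gs_accept_card_le[OF inst, of "fst (gs I k)"] gs_subset[of I k]
  by (simp add: gs_held_eq_accept)

lemma gs_refused_full:
  "(a, b) \<in> gs_refused I k \<Longrightarrow> card ((gs_held I k)\<inverse> `` {b}) = quota I b"
  using gs_accept_card_eq[OF inst, of "fst (gs I k)" a b] gs_subset[of I k]
  by (simp add: gs_held_eq_accept gs_refused_def)

lemma gs_refused_worse:
  "(a, b) \<in> gs_refused I k \<Longrightarrow> (t, b) \<in> gs_held I k \<Longrightarrow> lt_school I b a t"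
  using gs_accept_better[OF inst, of "fst (gs I k)" a b t] gs_subset[of I k]
  by (simp add: gs_held_eq_accept gs_refused_def)

text \<open>Nobody applies to the same school twice, and a school comes to hold a student only
  through an application.\<close>

lemma gs_refused_Suc: "gs_refused I k \<subseteq> gs_refused I (Suc k)"
proof -
  have "gs_applications I (gs I k) \<inter> fst (gs I k) = {}"
    using gs_applications_subset[of I "gs I k"] by blast
  then show ?thesis
    using gs_held_Suc_subset[of I k] by (auto simp: gs_refused_def gs_applied_Suc)
qed

lemma gs_refused_mono: "j \<le> k \<Longrightarrow> gs_refused I j \<subseteq> gs_refused I k"
  by (rule lift_Suc_mono_le[of "gs_refused I"]) (rule gs_refused_Suc)

lemma gs_rejected_Suc: "gs_rejected I (Suc k) = gs_refused I (Suc k) - gs_refused I k"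
  using gs_applications_subset[of I "gs I k"] gs_held_applied[of k]
  by (auto simp: gs_refused_def gs_applied_Suc simp del: gs_rejected.simps(1))

lemma gs_rejected_refused: "gs_rejected I k \<subseteq> gs_refused I k"
  by (cases k) (auto simp: gs_rejected_Suc simp del: gs_rejected.simps(2))

lemma gs_refusedE:
  assumes "(a, b) \<in> gs_refused I k"
  obtains j where "j \<le> k" "(a, b) \<in> gs_rejected I j"
proof -
  define j where "j = (LEAST j. (a, b) \<in> gs_refused I j)"
  have j: "(a, b) \<in> gs_refused I j" "j \<le> k"
    and least: "\<And>i. i < j \<Longrightarrow> (a, b) \<notin> gs_refused I i"
    unfolding j_def using assms by (auto intro: LeastI Least_le dest: not_less_Least)
  moreover have "j \<noteq> 0" using j(1) by (cases "j = 0") (auto simp: gs_refused_def gs_0)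
  then obtain i where "j = Suc i" by (cases j) auto
  then have "(a, b) \<in> gs_rejected I j"
    using j(1) least[of i] by (simp add: gs_rejected_Suc del: gs_rejected.simps)
  ultimately show ?thesis using that by blast
qed

lemma gs_application_unique:
  assumes "(a, b) \<in> gs_applications I (gs I k)" and "(a, c) \<in> gs_applications I (gs I k)"
  shows "b = c"
proof -
  have "strict_total_order_on (edges I `` {a} - fst (gs I k) `` {a}) (lt_student I a)"
    by (rule strict_total_order_on_subset[OF student_order[OF inst]]) blast
  then show ?thesis
    by (rule most_preferred_unique) (use assms in \<open>simp_all add: gs_applications_iff\<close>)
qed

lemma gs_application_worse:
  assumes "(a, b) \<in> gs_applications I (gs I k)" and "(a, c) \<in> edges I" and "lt_student I a b c"
  shows "(a, c) \<in> fst (gs I k)"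
proof (rule ccontr)
  assume nP: "(a, c) \<notin> fst (gs I k)"
  have ab: "(a, b) \<in> edges I" using assms(1) gs_applications_subset by blast
  then have "c \<noteq> b" using assms(3) student_irrefl[OF inst] by blast
  then have "lt_student I a c b"
    using assms(1,2) nP unfolding gs_applications_iff most_preferred_def by blast
  then show False using student_asym[OF inst ab assms(2,3)] by blast
qed

lemma gs_applied_closed:
  "(a, b) \<in> fst (gs I k) \<Longrightarrow> (a, c) \<in> edges I \<Longrightarrow> lt_student I a b c \<Longrightarrow> (a, c) \<in> fst (gs I k)"
proof (induction k)
  case 0
  then show ?case by (simp add: gs_0)
next
  case (Suc k)
  then show ?case using gs_application_worse[of a b k c] by (auto simp: gs_applied_Suc)
qed

text \<open>Students go down their lists, so the school holding a student is the lowest one applied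
  to so far. Held students do not apply, so only the step that forms the pair needs work.\<close>

lemma gs_held_last:
  "(a, b) \<in> gs_held I k \<Longrightarrow> (a, c) \<in> fst (gs I k) \<Longrightarrow> c = b \<or> lt_student I a b c"
proof (induction k)
  case 0
  then show ?case by (simp add: gs_0)
next
  case (Suc k)
  show ?case
  proof (cases "(a, b) \<in> gs_held I k")
    case True
    then have "(a, c) \<notin> gs_applications I (gs I k)" by (auto simp: gs_applications_iff)
    then show ?thesis using Suc True by (simp add: gs_applied_Suc)
  next
    case False
    then have app: "(a, b) \<in> gs_applications I (gs I k)"
      using Suc.prems(1) gs_held_Suc_subset by blast
    show ?thesis
    proof (cases "(a, c) \<in> gs_applications I (gs I k)")
      case True
      then show ?thesis using gs_application_unique[OF app] by blast
    next
      case False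
      then have c: "(a, c) \<in> fst (gs I k)" using Suc.prems(2) by (simp add: gs_applied_Suc)
      have b: "(a, b) \<in> edges I" "(a, b) \<notin> fst (gs I k)"
        using app gs_applications_subset by blast+
      then have "\<not> lt_student I a c b" using gs_applied_closed c by blast
      then show ?thesis using student_total[OF inst b(1), of c] c gs_subset[of I k] by blast
    qed
  qed
qed

lemma gs_held_unique:
  assumes "(a, b) \<in> gs_held I k" and "(a, c) \<in> gs_held I k"
  shows "b = c"
proof -
  have "(a, b) \<in> edges I" "(a, c) \<in> edges I" using assms gs_subset[of I k] by blast+
  then show ?thesis
    using assms gs_held_last[of a b k c] gs_held_last[of a c k b] gs_held_applied[of k]
      student_asym[OF inst, of a b c] by blast
qed

text \<open>Only students held nowhere apply, so within one step a student is in the pool of at most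
  one school. This separates steps in the later arguments about a first or last rejection.\<close>

lemma gs_rejected_not_held:
  assumes "(a, b) \<in> gs_rejected I k"
  shows "(a, c) \<notin> gs_held I k"
proof
  assume c: "(a, c) \<in> gs_held I k"
  obtain j where k: "k = Suc j" using assms by (cases k) auto
  have b: "(a, b) \<in> gs_held I j \<union> gs_applications I (gs I j)" "(a, b) \<notin> gs_held I k"
    using assms unfolding k by auto
  have "(a, c) \<in> gs_held I j \<union> gs_applications I (gs I j)"
    using c gs_held_Suc_subset unfolding k by blast
  then have "b = c"
    using b(1) gs_held_unique[of a b j c] gs_application_unique[of a b j c]
    by (auto simp: gs_applications_iff)
  then show False using b(2) c by blast
qed

lemma gs_output_final:
  "\<exists>n. gs_output I = gs_held I n \<and> gs_applications I (gs I n) = {} \<and>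
     (\<forall>k\<ge>n. gs I k = gs I n)"
proof -
  define n where "n = (LEAST n. gs_applications I (gs I n) = {})"
  have fin: "finite (edges I)" using inst by (rule instance_finite_edges)
  have n: "gs_applications I (gs I n) = {}"
    unfolding n_def by (rule LeastI_ex) (rule gs_terminates[OF fin])
  have "\<forall>k\<ge>n. gs I k = gs I n" using gs_stationary[OF fin n] by blast
  moreover have "gs_output I = gs_held I n" by (simp only: gs_output_def n_def)
  ultimately show ?thesis using n by blast
qed

lemma gs_applied_not_output_refused:
  assumes "(a, b) \<in> fst (gs I k)" and "(a, b) \<notin> gs_output I"
  shows "\<exists>m. (a, b) \<in> gs_refused I m"
proof -
  obtain n where n: "gs_output I = gs_held I n" "\<forall>k\<ge>n. gs I k = gs I n"
    using gs_output_final by blast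
  have "gs I (max k n) = gs I n" using n(2)[rule_format, of "max k n"] by simp
  moreover have "(a, b) \<in> fst (gs I (max k n))" using assms(1) gs_applied_mono[of k "max k n" I] by auto
  ultimately have "(a, b) \<in> gs_refused I (max k n)"
    using n(1) assms(2) by (simp add: gs_refused_def)
  then show ?thesis by blast
qed

text \<open>The bridge from runs to digraphs. At the end an unmatched student has exhausted the list
  and a matched one has applied to everything above the school held; conversely, the school held is
  the lowest one applied to.\<close>

lemma envy_gs_output: "envy I (gs_output I) = (\<Union>k. gs_refused I k)"
proof -
  obtain n where n: "gs_output I = gs_held I n" "gs_applications I (gs I n) = {}"
    "\<forall>k\<ge>n. gs I k = gs I n"
    using gs_output_final by blast
  have "(a, b) \<in> envy I (gs_output I) \<longleftrightarrow> (a, b) \<in> gs_refused I n" for a b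
  proof
    assume L: "(a, b) \<in> envy I (gs_output I)"
    then have ab: "(a, b) \<in> edges I" and nH: "(a, b) \<notin> gs_held I n"
      and pr: "\<And>c. (a, c) \<in> gs_held I n \<Longrightarrow> lt_student I a c b"
      by (auto simp: envy_def n(1) prefers_to_assigned_def)
    have "(a, b) \<in> fst (gs I n)"
    proof (cases "gs_held I n `` {a} = {}")
      case True
      show ?thesis
      proof (rule ccontr)
        assume "\<not> ?thesis"
        then have "b \<in> edges I `` {a} - fst (gs I n) `` {a}" using ab by blast
        moreover have "strict_total_order_on (edges I `` {a} - fst (gs I n) `` {a}) (lt_student I a)"
          by (rule strict_total_order_on_subset[OF student_order[OF inst]]) blast
        moreover have "finite (edges I `` {a})"
          by (intro finite_schools_of instance_finite_edges inst)
        ultimately obtain c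
          where "most_preferred (lt_student I a) (edges I `` {a} - fst (gs I n) `` {a}) c"
          using most_preferred_exists[of "edges I `` {a} - fst (gs I n) `` {a}"] finite_Diff by blast
        then have "(a, c) \<in> gs_applications I (gs I n)" using True by (simp add: gs_applications_iff)
        then show False using n(2) by simp
      qed
    next
      case False
      then obtain c where c: "(a, c) \<in> gs_held I n" by blast
      then show ?thesis using gs_applied_closed[OF _ ab pr[OF c]] gs_held_applied by blast
    qed
    then show "(a, b) \<in> gs_refused I n" using nH by (simp add: gs_refused_def)
  next
    assume "(a, b) \<in> gs_refused I n"
    then have R: "(a, b) \<in> fst (gs I n)" "(a, b) \<notin> gs_held I n" by (auto simp: gs_refused_def)
    then show "(a, b) \<in> envy I (gs_output I)"
      using gs_subset[of I n] gs_held_last[of a _ n b]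
      by (auto simp: envy_def n(1) prefers_to_assigned_def)
  qed
  moreover have "gs_refused I k \<subseteq> gs_refused I n" for k
  proof -
    have "gs_refused I k \<subseteq> gs_refused I (max k n)" by (rule gs_refused_mono) simp
    also have "\<dots> = gs_refused I n" using n(3)[rule_format, of "max k n"] by (simp add: gs_refused_def)
    finally show ?thesis .
  qed
  ultimately show ?thesis by auto
qed

lemma gs_output_stable: "stable I (gs_output I)"
proof -
  obtain n where n: "gs_output I = gs_held I n" "gs_applications I (gs I n) = {}"
    "\<forall>k\<ge>n. gs I k = gs I n"
    using gs_output_final by blast
  have "card (gs_held I n `` {a}) \<le> 1" for a
  proof (cases "gs_held I n `` {a} = {}")
    case False
    then obtain b where "(a, b) \<in> gs_held I n" by blast
    then have "gs_held I n `` {a} = {b}" using gs_held_unique by blast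
    then show ?thesis by simp
  qed simp
  then have "assignment I (gs_output I)"
    unfolding assignment_def using gs_subset[of I n] gs_held_card_le by (simp add: n(1))
  moreover have "\<not> blocks I (gs_output I) a b" for a b
  proof
    assume bl: "blocks I (gs_output I) a b"
    have "(a, b) \<notin> gs_output I"
      using bl student_irrefl[OF inst, of a b] by (auto simp: blocks_def prefers_to_assigned_def)
    then have "(a, b) \<in> envy I (gs_output I)"
      using bl by (simp add: envy_def blocks_def)
    then obtain k where "(a, b) \<in> gs_refused I k" by (auto simp: envy_gs_output)
    then have R: "(a, b) \<in> gs_refused I (max k n)" using gs_refused_mono[of k "max k n"] by auto
    have H: "gs_held I (max k n) = gs_output I" using n(3)[rule_format, of "max k n"] n(1) by simp
    obtain a' where "(a', b) \<in> gs_output I" "lt_school I b a' a"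
      using bl gs_refused_full[OF R] by (auto simp: blocks_def H)
    moreover have "lt_school I b a a'" if "(a', b) \<in> gs_output I" for a'
      using gs_refused_worse[OF R] that by (simp add: H)
    ultimately show False
      using school_asym[OF inst, of a b a'] bl gs_subset[of I n] by (auto simp: blocks_def n(1))
  qed
  ultimately show ?thesis by (simp add: stable_def)
qed

end

section \<open>Student-optimality of the Gale--Shapley output\<close>

lemma assignment_functional:
  assumes "stable_assignment_instance I" and "assignment I M" and "(a, b) \<in> M" and "(a, c) \<in> M"
  shows "b = c"
proof -
  have "M \<subseteq> edges I" using assms(2) by (simp add: assignment_def)
  then have "finite (M `` {a})"
    by (intro finite_schools_of finite_subset[OF _ instance_finite_edges[OF assms(1)]])
  moreover have "a \<in> students I"
    using \<open>M \<subseteq> edges I\<close> assms(1,3) by (auto simp: stable_assignment_instance_def)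
  ultimately have "card (M `` {a}) \<le> Suc 0" using assms(2) by (simp add: assignment_def)
  then show ?thesis using card_le_Suc0_iff_eq[OF \<open>finite (M `` {a})\<close>] assms(3,4) by blast
qed

lemma assignment_card_le:
  assumes "stable_assignment_instance I" and "assignment I M"
  shows "card (M\<inverse> `` {b}) \<le> quota I b"
proof (cases "b \<in> schools I")
  case False
  then have "M\<inverse> `` {b} = {}"
    using assms by (auto simp: assignment_def stable_assignment_instance_def)
  then show ?thesis by simp
qed (use assms in \<open>auto simp: assignment_def\<close>)

text \<open>
  The classical argument for student-optimality (the case of empty \<open>S\<close>): at the first rejection of
  a pair of \<open>N\<close>, a student held in its place forms a blocking pair.
\<close>

lemma gs_output_dominates:
  assumes inst: "stable_assignment_instance I"
    and harmless: "\<And>j x a b. (x, b) \<in> gs_rejected I j \<Longrightarrow> (x, b) \<notin> S \<Longrightarrow> (a, b) \<in> gs_held I j \<Longrightarrow>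
      (a, b) \<notin> S"
    and N: "stable (I\<lparr>edges := edges I - S\<rparr>) N" and ab: "(a, b) \<in> N"
  shows "\<exists>b'\<in>gs_output I `` {a}. b' = b \<or> lt_student I a b b'"
proof -
  let ?J = "I\<lparr>edges := edges I - S\<rparr>"
  have instJ: "stable_assignment_instance ?J" using inst by (rule instance_delete_edges)
  have asgJ: "assignment ?J N" using N by (simp add: stable_def)
  have NE: "N \<subseteq> edges I - S" using asgJ by (simp add: assignment_def)
  have none: "N \<inter> gs_rejected I j = {}" for j
  proof (induction j rule: less_induct)
    case (less j)
    show ?case
    proof (rule ccontr)
      assume "N \<inter> gs_rejected I j \<noteq> {}"
      then obtain x c where x: "(x, c) \<in> N" "(x, c) \<in> gs_rejected I j" by auto
      then have R: "(x, c) \<in> gs_refused I j" using gs_rejected_refused[OF inst] by blast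
      then have nH: "(x, c) \<notin> gs_held I j" by (simp add: gs_refused_def)
      have finN: "finite (N\<inverse> `` {c})"
        using NE by (intro finite_students_of finite_subset[OF _ instance_finite_edges[OF inst]]) blast
      \<comment> \<open>At step \<open>j\<close> the school \<open>c\<close> is full without
        \<open>x\<close>, whereas \<open>N\<close> respects the quota and gives \<open>x\<close> to
        \<open>c\<close>; so some holder is not assigned to \<open>c\<close> by
        \<open>N\<close>.\<close>
      have "\<not> (gs_held I j)\<inverse> `` {c} \<subseteq> N\<inverse> `` {c}"
      proof
        assume "(gs_held I j)\<inverse> `` {c} \<subseteq> N\<inverse> `` {c}"
        moreover have "card (N\<inverse> `` {c}) \<le> card ((gs_held I j)\<inverse> `` {c})"
          using assignment_card_le[OF instJ asgJ, of c] gs_refused_full[OF inst R] by simp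
        ultimately have "(gs_held I j)\<inverse> `` {c} = N\<inverse> `` {c}"
          using card_seteq finN by blast
        then show False using x(1) nH by blast
      qed
      then obtain h where h: "(h, c) \<in> gs_held I j" "(h, c) \<notin> N" by blast
      \<comment> \<open>As \<open>(x, c)\<close> lies in \<open>N\<close> it is not in
        \<open>S\<close>, so \<open>harmless\<close> keeps \<open>(h, c)\<close> outside
        \<open>S\<close>: the blocking pair must be an edge of the reduced instance.\<close>
      have hJ: "(h, c) \<in> edges I - S"
        using harmless[OF x(2) _ h(1)] x(1) NE h(1) gs_subset[of I j] by blast
      have "lt_student I h d c" if d: "(h, d) \<in> N" for d
      proof (rule ccontr)
        assume "\<not> lt_student I h d c"
        moreover have "d \<noteq> c" using d h(2) by blast
        ultimately have "lt_student I h c d"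
          using student_total[OF inst, of h c d] hJ d NE by blast
        then have dP: "(h, d) \<in> fst (gs I j)"
          using gs_applied_closed[OF inst, of h c j d] gs_held_applied[OF inst, of j] h(1) d NE
          by blast
        moreover have "(h, d) \<notin> gs_held I j"
          using gs_held_unique[OF inst h(1)] \<open>d \<noteq> c\<close> by blast
        ultimately have "(h, d) \<in> gs_refused I j" by (simp add: gs_refused_def)
        then obtain i where i: "i \<le> j" "(h, d) \<in> gs_rejected I i"
          using gs_refusedE[OF inst] by blast
        then have "i \<noteq> j" using gs_rejected_not_held[OF inst] h(1) by blast
        then show False using less.IH[of i] i d by auto
      qed
      then have "blocks ?J N h c"
        using hJ x(1) gs_refused_worse[OF inst R h(1)]
        by (auto simp: blocks_def prefers_to_assigned_def)
      then show False using N by (simp add: stable_def)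
    qed
  qed
  then have "(a, b) \<notin> gs_refused I k" for k
    using gs_refusedE[OF inst, of a b k] ab by blast
  then have "(a, b) \<notin> envy I (gs_output I)" by (auto simp: envy_gs_output[OF inst])
  then consider "(a, b) \<in> gs_output I"
    | c where "(a, c) \<in> gs_output I" "\<not> lt_student I a c b"
    using ab NE by (auto simp: envy_def prefers_to_assigned_def)
  then show ?thesis
  proof cases
    case 2
    moreover have "gs_output I \<subseteq> edges I" using gs_output_stable[OF inst]
      by (simp add: stable_def assignment_def)
    ultimately show ?thesis using student_total[OF inst, of a b c] ab NE by blast
  qed auto
qed

lemma gs_output_optimal:
  assumes "stable_assignment_instance I"
  shows "student_optimal_stable I (gs_output I)"
  unfolding student_optimal_stable_def
  using gs_output_stable[OF assms] gs_output_dominates[OF assms, of "{}"] by auto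

lemma student_optimal_stable_unique:
  assumes inst: "stable_assignment_instance I"
    and M: "student_optimal_stable I M" and N: "student_optimal_stable I N"
  shows "M = N"
proof -
  have "X \<subseteq> Y" if X: "student_optimal_stable I X" and Y: "student_optimal_stable I Y" for X Y
  proof clarify
    fix a b assume ab: "(a, b) \<in> X"
    have asgX: "assignment I X" and asgY: "assignment I Y"
      using X Y by (auto simp: student_optimal_stable_def stable_def)
    obtain c where c: "(a, c) \<in> Y" "c = b \<or> lt_student I a b c"
      using X Y ab unfolding student_optimal_stable_def by blast
    obtain d where d: "(a, d) \<in> X" "d = c \<or> lt_student I a c d"
      using X Y c(1) unfolding student_optimal_stable_def by blast
    have "d = b" using assignment_functional[OF inst asgX] d ab by blast
    moreover have "(a, b) \<in> edges I" "(a, c) \<in> edges I"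
      using ab c asgX asgY by (auto simp: assignment_def)
    ultimately show "(a, b) \<in> Y" using c d student_asym[OF inst, of a b c] by blast
  qed
  then show ?thesis using M N by blast
qed

section \<open>Envy and the school-rotation digraph\<close>

lemma envy_subset: "envy I M \<subseteq> edges I"
  by (auto simp: envy_def)

lemma envy_delete: "envy (I\<lparr>edges := edges I - X\<rparr>) M = envy I M - X"
  by (auto simp: envy_def prefers_to_assigned_def)

lemma is_s_iff:
  "is_s I M b a \<longleftrightarrow>
     (a, b) \<in> envy I M \<and> (\<forall>a'. (a', b) \<in> envy I M \<longrightarrow> a' \<noteq> a \<longrightarrow> lt_school I b a' a)"
  by (auto simp: is_s_def most_preferred_def envy_def)

lemma is_s_unique:
  assumes "stable_assignment_instance I" and "is_s I M b a" and "is_s I M b a'"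
  shows "a = a'"
  using assms(2,3) school_asym[OF assms(1), of a b a'] envy_subset[of I M] unfolding is_s_iff by blast

lemma is_s_exists:
  assumes inst: "stable_assignment_instance I" and "(a, b) \<in> envy I M"
  shows "\<exists>x. is_s I M b x"
proof -
  let ?S = "(envy I M)\<inverse> `` {b}"
  have "strict_total_order_on ?S (lt_school I b)"
    by (rule strict_total_order_on_subset[OF school_order[OF inst]]) (use envy_subset in blast)
  moreover have "finite ?S"
    by (intro finite_students_of finite_subset[OF envy_subset] instance_finite_edges inst)
  moreover have "?S \<noteq> {}" using assms(2) by blast
  ultimately obtain x where "most_preferred (lt_school I b) ?S x"
    by (rule most_preferred_exists)
  then show ?thesis by (auto simp: is_s_iff most_preferred_def)
qed

text \<open>The form in which stability is mostly used: an envious pair that does not block means a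
  full school whose students all rank higher.\<close>

lemma stable_envyD:
  assumes inst: "stable_assignment_instance I" and M: "stable I M" and ab: "(a, b) \<in> envy I M"
  shows "card (M\<inverse> `` {b}) = quota I b" and "(t, b) \<in> M \<Longrightarrow> lt_school I b a t"
proof -
  have asg: "assignment I M" and "\<not> blocks I M a b" using M by (auto simp: stable_def)
  then have nb: "\<not> card (M\<inverse> `` {b}) < quota I b" "\<And>t. (t, b) \<in> M \<Longrightarrow> \<not> lt_school I b t a"
    using ab by (auto simp: blocks_def envy_def)
  then show "card (M\<inverse> `` {b}) = quota I b"
    using assignment_card_le[OF inst asg, of b] by simp
  show "lt_school I b a t" if "(t, b) \<in> M"
    using nb(2)[OF that] school_total[OF inst, of a b t] that ab asg
    by (auto simp: envy_def assignment_def)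
qed

lemma blocks_envy:
  assumes "stable_assignment_instance I" and "blocks I M a b"
  shows "(a, b) \<in> envy I M"
  using assms(2) student_irrefl[OF assms(1), of a b]
  by (auto simp: blocks_def envy_def prefers_to_assigned_def)

lemma stable_delete_edges:
  assumes "stable I M" and "M \<inter> X = {}"
  shows "stable (I\<lparr>edges := edges I - X\<rparr>) M"
  using assms by (auto simp: stable_def assignment_def blocks_def prefers_to_assigned_def)

lemma digraph_iff:
  "(School b, Student a) \<in> school_rotation_digraph I M \<longleftrightarrow> is_s I M b a"
  "(Student a, School c) \<in> school_rotation_digraph I M \<longleftrightarrow> (\<exists>b. is_s I M b a) \<and> (a, c) \<in> M"
  "(Student a, Unmatched) \<in> school_rotation_digraph I M \<longleftrightarrow> (\<exists>b. is_s I M b a) \<and> M `` {a} = {}"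
  "(Student a, Student a') \<notin> school_rotation_digraph I M"
  "Unmatched \<notin> Domain (school_rotation_digraph I M)"
  "School b \<in> Domain (school_rotation_digraph I M) \<longleftrightarrow> (\<exists>a. is_s I M b a)"
  unfolding school_rotation_digraph_def by blast+

lemma digraph_empty_iff:
  assumes "stable_assignment_instance I"
  shows "school_rotation_digraph I M = {} \<longleftrightarrow> envy I M = {}"
proof -
  have "school_rotation_digraph I M = {} \<longleftrightarrow> (\<forall>a b. \<not> is_s I M b a)"
    by (auto simp: school_rotation_digraph_def)
  also have "\<dots> \<longleftrightarrow> envy I M = {}"
  proof (intro iffI)
    show "envy I M = {}" if "\<forall>a b. \<not> is_s I M b a"
      using that is_s_exists[OF assms, of _ _ M] by auto
  qed (simp add: is_s_iff)
  finally show ?thesis .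
qed

text \<open>Case (i) of the algorithm without the digraph: the vertex after \<open>a\<close> is a
  sink. \<open>Unmatched\<close> always is one, which makes the condition vacuous; a school is one
  iff nobody envies it.\<close>

definition removable :: "('a, 'b) assignment_instance \<Rightarrow> ('a \<times> 'b) set \<Rightarrow> 'a \<Rightarrow> 'b \<Rightarrow> bool" where
  "removable I M a b \<longleftrightarrow> is_s I M b a \<and> (\<forall>c x. (a, c) \<in> M \<longrightarrow> (x, c) \<notin> envy I M)"

lemma removable_step:
  assumes "removable I M a b"
  shows "srr_step C (I, M) (I\<lparr>edges := edges I - removed_edges C I a b\<rparr>, M)"
proof -
  have s: "is_s I M b a" and snk: "\<And>c. (a, c) \<in> M \<Longrightarrow> \<nexists>x. is_s I M c x"
    using assms by (auto simp: removable_def is_s_iff)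
  obtain v where "(Student a, v) \<in> school_rotation_digraph I M"
    "v \<notin> Domain (school_rotation_digraph I M)"
  proof (cases "M `` {a} = {}")
    case True
    then show ?thesis using that[of Unmatched] s by (auto simp: digraph_iff)
  next
    case False
    then obtain c where "(a, c) \<in> M" by blast
    then show ?thesis using that[of "School c"] s snk by (auto simp: digraph_iff)
  qed
  then show ?thesis using s by (intro srr_remove) (simp_all add: digraph_iff)
qed

lemma srr_stepE [consumes 3]:
  assumes inst: "stable_assignment_instance I" and asg: "assignment I M"
    and step: "srr_step C (I, M) s"
  obtains (remove) a b where "removable I M a b"
      "s = (I\<lparr>edges := edges I - removed_edges C I a b\<rparr>, M)"
    | (rotate) \<rho> where "school_rotation I M \<rho>" "s = (I, apply_rotation M \<rho>)"
  using step
proof cases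
  case (srr_remove b a v)
  have "(x, c) \<notin> envy I M" if "(a, c) \<in> M" for x c
  proof (cases v)
    case (Student a')
    then show ?thesis using srr_remove by (simp add: digraph_iff)
  next
    case (School c')
    then have "c' = c" using srr_remove that assignment_functional[OF inst asg]
      by (auto simp: digraph_iff)
    then show ?thesis using srr_remove School is_s_exists[OF inst, of x c M]
      by (auto simp: digraph_iff)
  next
    case Unmatched
    then show ?thesis using srr_remove that by (auto simp: digraph_iff)
  qed
  then have "removable I M a b" using srr_remove by (simp add: removable_def digraph_iff)
  then show ?thesis using remove srr_remove by blast
next
  case (srr_rotate \<rho>)
  then show ?thesis using rotate by blast
qed

lemma removed_edges_school: "(x, c) \<in> removed_edges C I a b \<Longrightarrow> c = b"
  by (auto simp: removed_edges_def split: if_splits)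

lemma removed_edges_self: "(a, b) \<in> removed_edges C I a b"
  by (simp add: removed_edges_def)

lemma removed_edges_delete [simp]:
  "removed_edges C (I\<lparr>edges := F\<rparr>) a b = removed_edges C I a b"
  by (simp add: removed_edges_def)

text \<open>An envious student ranks below everyone assigned to the school, so neither that edge nor
  a lower one carries the assignment.\<close>

lemma removed_edges_disjoint:
  assumes inst: "stable_assignment_instance I" and M: "stable I M" and s: "is_s I M b a"
  shows "M \<inter> removed_edges C I a b = {}"
proof (rule ccontr)
  assume "M \<inter> removed_edges C I a b \<noteq> {}"
  then obtain x c where x: "(x, c) \<in> M" "(x, c) \<in> removed_edges C I a b" by auto
  have e: "(a, b) \<in> envy I M" using s by (simp add: is_s_iff)
  have c: "c = b" using x(2) by (rule removed_edges_school)
  have "lt_school I b a x" using stable_envyD(2)[OF inst M e] x(1) c by blast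
  moreover have "x = a \<or> lt_school I b x a"
    using x(2) by (auto simp: removed_edges_def split: if_splits)
  moreover have "(a, b) \<in> edges I" "(x, b) \<in> edges I"
    using e x(1) c M by (auto simp: envy_def stable_def assignment_def)
  ultimately show False using school_irrefl[OF inst] school_asym[OF inst] by blast
qed

lemma Suc_mod_surj:
  assumes "j < r"
  obtains i where "i < r" "Suc i mod r = j"
proof (cases j)
  case 0
  then show ?thesis using assms that[of "r - 1"] by simp
next
  case (Suc i)
  then show ?thesis using assms that[of i] by simp
qed

lemma Suc_mod_inj: "i < r \<Longrightarrow> j < r \<Longrightarrow> Suc i mod r = Suc j mod r \<Longrightarrow> i = (j::nat)"
  by (auto simp: mod_Suc split: if_splits)

section \<open>Applying a school-rotation\<close>

text \<open>The pairs gained by a rotation; those lost are \<open>set \<rho>\<close>. Working with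
  these two sets removes most index arithmetic.\<close>

definition rotation_pairs :: "('a \<times> 'b) list \<Rightarrow> ('a \<times> 'b) set" where
  "rotation_pairs \<rho> = {(fst (\<rho> ! (Suc i mod length \<rho>)), snd (\<rho> ! i)) | i. i < length \<rho>}"

lemma apply_rotation_eq: "apply_rotation M \<rho> = (M - set \<rho>) \<union> rotation_pairs \<rho>"
  by (simp add: apply_rotation_def rotation_pairs_def)

lemma rotation_pairs_students: "fst ` rotation_pairs \<rho> = fst ` set \<rho>"
proof (intro equalityI subsetI)
  fix a assume "a \<in> fst ` rotation_pairs \<rho>"
  then obtain i where "i < length \<rho>" "a = fst (\<rho> ! (Suc i mod length \<rho>))"
    by (auto simp: rotation_pairs_def)
  moreover from this have "\<rho> ! (Suc i mod length \<rho>) \<in> set \<rho>"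
    by (intro nth_mem mod_less_divisor) linarith
  ultimately show "a \<in> fst ` set \<rho>" by blast
next
  fix a assume "a \<in> fst ` set \<rho>"
  then obtain j where j: "j < length \<rho>" "a = fst (\<rho> ! j)" by (auto simp: in_set_conv_nth)
  obtain i where "i < length \<rho>" "Suc i mod length \<rho> = j" using Suc_mod_surj[OF j(1)] .
  then have "(a, snd (\<rho> ! i)) \<in> rotation_pairs \<rho>" using j by (auto simp: rotation_pairs_def)
  then show "a \<in> fst ` rotation_pairs \<rho>" by force
qed

lemma rotation_pairs_schools: "snd ` rotation_pairs \<rho> = snd ` set \<rho>"
  by (force simp: rotation_pairs_def in_set_conv_nth image_iff)

text \<open>An arc leaving a student requires some school pointing at that student. On a cycle the
  preceding school does so, and the condition disappears.\<close>

lemma school_rotation_iff: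
  "school_rotation I M \<rho> \<longleftrightarrow>
     \<rho> \<noteq> [] \<and> distinct (map fst \<rho>) \<and> distinct (map snd \<rho>) \<and> set \<rho> \<subseteq> M \<and>
     (\<forall>(a, b)\<in>rotation_pairs \<rho>. is_s I M b a)" (is "?L \<longleftrightarrow> ?R")
proof
  assume L: ?L
  have "x \<in> M" if x: "x \<in> set \<rho>" for x
  proof -
    obtain i where "i < length \<rho>" "x = \<rho> ! i" using x by (metis in_set_conv_nth)
    then show ?thesis using L by (auto simp: school_rotation_def digraph_iff)
  qed
  then show ?R using L by (auto simp: school_rotation_def rotation_pairs_def digraph_iff)
next
  assume R: ?R
  have "(fst (\<rho> ! i), snd (\<rho> ! i)) \<in> M" "is_s I M (snd (\<rho> ! i)) (fst (\<rho> ! (Suc i mod length \<rho>)))"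
    "\<exists>b. is_s I M b (fst (\<rho> ! i))" if i: "i < length \<rho>" for i
  proof -
    have "\<rho> ! i \<in> M" using R nth_mem[OF i] by blast
    then show "(fst (\<rho> ! i), snd (\<rho> ! i)) \<in> M" by simp
    show "is_s I M (snd (\<rho> ! i)) (fst (\<rho> ! (Suc i mod length \<rho>)))"
      using R i by (auto simp: rotation_pairs_def)
    have "fst (\<rho> ! i) \<in> fst ` rotation_pairs \<rho>"
      using nth_mem[OF i] by (simp add: rotation_pairs_students)
    then obtain b where "(fst (\<rho> ! i), b) \<in> rotation_pairs \<rho>" by force
    then show "\<exists>b. is_s I M b (fst (\<rho> ! i))" using R by blast
  qed
  then show ?L using R unfolding school_rotation_def digraph_iff by blast
qed

context
  fixes I :: "('a, 'b) assignment_instance" and M :: "('a \<times> 'b) set" and \<rho> :: "('a \<times> 'b) list"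
  assumes inst: "stable_assignment_instance I" and M: "stable I M"
    and rot: "school_rotation I M \<rho>"
begin

lemma rotation_functional: "(a, b) \<in> M \<Longrightarrow> (a, c) \<in> M \<Longrightarrow> b = c"
  using assignment_functional[OF inst, of M a b c] M by (simp add: stable_def)

lemma rotation_mem_iff: "(a, b) \<in> M \<Longrightarrow> (a, b) \<in> set \<rho> \<longleftrightarrow> a \<in> fst ` set \<rho>"
proof
  assume ab: "(a, b) \<in> M" and "a \<in> fst ` set \<rho>"
  then obtain c where c: "(a, c) \<in> set \<rho>" by force
  then have "(a, c) \<in> M" using rot by (auto simp: school_rotation_iff)
  then show "(a, b) \<in> set \<rho>" using rotation_functional[OF ab] c by blast
qed force

lemma rotation_pairs_is_s: "(a, b) \<in> rotation_pairs \<rho> \<Longrightarrow> is_s I M b a"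
  using rot by (auto simp: school_rotation_iff)

lemma rotation_pairs_envy: "rotation_pairs \<rho> \<subseteq> envy I M"
  using rotation_pairs_is_s by (auto simp: is_s_iff)

lemma rotation_pairs_functional:
  assumes "(a, b) \<in> rotation_pairs \<rho>" and "(a, c) \<in> rotation_pairs \<rho>"
  shows "b = c"
proof -
  let ?r = "length \<rho>"
  obtain i j where i: "i < ?r" "a = fst (\<rho> ! (Suc i mod ?r))" "b = snd (\<rho> ! i)"
    and j: "j < ?r" "a = fst (\<rho> ! (Suc j mod ?r))" "c = snd (\<rho> ! j)"
    using assms by (auto simp: rotation_pairs_def)
  have "Suc i mod ?r < ?r" "Suc j mod ?r < ?r" using i(1) by (auto intro: mod_less_divisor)
  moreover have "distinct (map fst \<rho>)" using rot by (simp add: school_rotation_def)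
  ultimately have "Suc i mod ?r = Suc j mod ?r"
    using i(2) j(2) nth_eq_iff_index_eq[of "map fst \<rho>" "Suc i mod ?r" "Suc j mod ?r"] by simp
  then show ?thesis using Suc_mod_inj i j by blast
qed

lemma mem_apply_rotation:
  "(a, b) \<in> apply_rotation M \<rho> \<longleftrightarrow> (if a \<in> fst ` set \<rho> then (a, b) \<in> rotation_pairs \<rho> else (a, b) \<in> M)"
proof (cases "a \<in> fst ` set \<rho>")
  case True
  then show ?thesis using rotation_mem_iff[of a b] by (auto simp: apply_rotation_eq)
next
  case False
  then have "(a, b) \<notin> rotation_pairs \<rho>"
    using rotation_pairs_students[of \<rho>] by (metis fst_conv image_eqI)
  then show ?thesis using rotation_mem_iff[of a b] False by (auto simp: apply_rotation_eq)
qed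

lemma envy_apply_rotation_outside:
  "a \<notin> fst ` set \<rho> \<Longrightarrow> (a, b) \<in> envy I (apply_rotation M \<rho>) \<longleftrightarrow> (a, b) \<in> envy I M"
  by (simp add: envy_def prefers_to_assigned_def mem_apply_rotation Image_def)

text \<open>Rotated students move to a school they envied, so by transitivity whatever they envy now
  they envied before; the others keep their school. Strictness comes from the gained pairs, which
  were envious.\<close>

lemma envy_apply_rotation: "envy I (apply_rotation M \<rho>) \<subset> envy I M"
proof
  show "envy I (apply_rotation M \<rho>) \<subseteq> envy I M"
  proof clarify
    fix a b assume e: "(a, b) \<in> envy I (apply_rotation M \<rho>)"
    show "(a, b) \<in> envy I M"
    proof (cases "a \<in> fst ` set \<rho>")
      case False
      then show ?thesis using e envy_apply_rotation_outside by blast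
    next
      case True
      then obtain c where c: "(a, c) \<in> rotation_pairs \<rho>"
        using rotation_pairs_students[of \<rho>] by force
      then have ac: "(a, c) \<in> envy I M" using rotation_pairs_envy by blast
      have "(a, c) \<in> apply_rotation M \<rho>" using True c by (simp add: mem_apply_rotation)
      then have cb: "lt_student I a c b" using e by (auto simp: envy_def prefers_to_assigned_def)
      have ab: "(a, b) \<in> edges I" using e envy_subset by blast
      have "lt_student I a d b" if d: "(a, d) \<in> M" for d
      proof -
        have "lt_student I a d c" using ac d by (auto simp: envy_def prefers_to_assigned_def)
        moreover have "(a, d) \<in> edges I" using d M by (auto simp: stable_def assignment_def)
        ultimately show ?thesis using student_trans[OF inst, of a d c b] cb ab ac envy_subset by blast
      qed
      then show ?thesis using ab student_irrefl[OF inst ab]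
        by (auto simp: envy_def prefers_to_assigned_def)
    qed
  qed
  have "rotation_pairs \<rho> \<noteq> {}" using rot rotation_pairs_students[of \<rho>] by (auto simp: school_rotation_def)
  then obtain a b where ab: "(a, b) \<in> rotation_pairs \<rho>" by auto
  then have "(a, b) \<in> apply_rotation M \<rho>" by (simp add: apply_rotation_eq)
  then show "envy I (apply_rotation M \<rho>) \<noteq> envy I M"
    using ab rotation_pairs_envy by (auto simp: envy_def)
qed

text \<open>The schools on a rotation are distinct and each points at a single student, so each
  gives up exactly one student and receives exactly one.\<close>

lemma card_apply_rotation: "card ((apply_rotation M \<rho>)\<inverse> `` {b}) = card (M\<inverse> `` {b})"
proof (cases "b \<in> snd ` set \<rho>")
  case False
  have "(a, b) \<in> apply_rotation M \<rho> \<longleftrightarrow> (a, b) \<in> M" for a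
    using False rotation_pairs_schools[of \<rho>] unfolding apply_rotation_eq by force
  then have "(apply_rotation M \<rho>)\<inverse> `` {b} = M\<inverse> `` {b}" by auto
  then show ?thesis by simp
next
  case True
  then obtain a where a: "(a, b) \<in> set \<rho>" by force
  obtain a' where a': "(a', b) \<in> rotation_pairs \<rho>"
    using True rotation_pairs_schools[of \<rho>] by force
  have dist: "distinct (map snd \<rho>)" using rot by (simp add: school_rotation_def)
  have ua: "x = a" if "(x, b) \<in> set \<rho>" for x
    using that a dist inj_onD[of snd "set \<rho>" "(x, b)" "(a, b)"] by (simp add: distinct_map)
  have ua': "x = a'" if "(x, b) \<in> rotation_pairs \<rho>" for x
    using that a' rotation_pairs_is_s is_s_unique[OF inst] by blast
  have aM: "(a, b) \<in> M" using a rot by (auto simp: school_rotation_iff)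
  have a'M: "(a', b) \<notin> M" using a' rotation_pairs_envy by (auto simp: envy_def)
  have "(x, b) \<in> apply_rotation M \<rho> \<longleftrightarrow> x = a' \<or> (x, b) \<in> M \<and> x \<noteq> a" for x
    using ua[of x] ua'[of x] a a' unfolding apply_rotation_eq by blast
  then have "(apply_rotation M \<rho>)\<inverse> `` {b} = insert a' (M\<inverse> `` {b} - {a})" by auto
  moreover have "finite (M\<inverse> `` {b})"
    using M by (intro finite_students_of finite_subset[OF _ instance_finite_edges[OF inst]])
      (simp add: stable_def assignment_def)
  ultimately show ?thesis using aM a'M card.remove[of "M\<inverse> `` {b}" a] by simp
qed

text \<open>Whoever envies a school afterwards envied it before, hence ranks below its old students;
  the newcomer was the best of the envious students, so ranks higher too.\<close>

lemma apply_rotation_stable: "stable I (apply_rotation M \<rho>)"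
proof -
  let ?M' = "apply_rotation M \<rho>"
  have asg: "assignment I M" using M by (simp add: stable_def)
  have fn: "b = c" if "(a, b) \<in> ?M'" "(a, c) \<in> ?M'" for a b c
    using that rotation_functional rotation_pairs_functional
    by (auto simp: mem_apply_rotation split: if_splits)
  have sub: "?M' \<subseteq> edges I"
    using asg rotation_pairs_envy envy_subset[of I M] by (auto simp: apply_rotation_eq assignment_def)
  have "card (?M' `` {a}) \<le> 1" for a
  proof (cases "?M' `` {a} = {}")
    case False
    then obtain b where "(a, b) \<in> ?M'" by blast
    then have "?M' `` {a} = {b}" using fn by blast
    then show ?thesis by simp
  qed simp
  then have "assignment I ?M'"
    using sub asg by (simp add: assignment_def card_apply_rotation)
  moreover have "\<not> blocks I ?M' a b" for a b
  proof
    assume bl: "blocks I ?M' a b"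
    then have e': "(a, b) \<in> envy I ?M'" using blocks_envy[OF inst] by blast
    then have e: "(a, b) \<in> envy I M" using envy_apply_rotation by blast
    obtain t where t: "(t, b) \<in> ?M'" "lt_school I b t a"
      using bl stable_envyD(1)[OF inst M e] by (auto simp: blocks_def card_apply_rotation)
    have "lt_school I b a t"
    proof (cases "(t, b) \<in> M")
      case True
      then show ?thesis using stable_envyD(2)[OF inst M e] by blast
    next
      case False
      then have "is_s I M b t" using t(1) rotation_pairs_is_s by (auto simp: apply_rotation_eq)
      moreover have "a \<noteq> t" using e' t(1) by (auto simp: envy_def)
      ultimately show ?thesis using e by (simp add: is_s_iff)
    qed
    then show False using t sub e envy_subset school_asym[OF inst, of a b t] by blast
  qed
  ultimately show ?thesis by (simp add: stable_def)
qed

end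

section \<open>Rotations and the student-optimal assignment\<close>

lemma student_optimal_no_rotation:
  assumes inst: "stable_assignment_instance I" and M: "student_optimal_stable I M"
  shows "\<not> school_rotation I M \<rho>"
proof
  assume rot: "school_rotation I M \<rho>"
  have st: "stable I M" using M by (simp add: student_optimal_stable_def)
  have ne: "rotation_pairs \<rho> \<noteq> {}"
    using rot rotation_pairs_students[of \<rho>] by (auto simp: school_rotation_def)
  then obtain a b where ab: "(a, b) \<in> rotation_pairs \<rho>" by auto
  then have "(a, b) \<in> apply_rotation M \<rho>" by (simp add: apply_rotation_eq)
  moreover have "stable I (apply_rotation M \<rho>)" by (rule apply_rotation_stable[OF inst st rot])
  ultimately obtain c where c: "(a, c) \<in> M" "c = b \<or> lt_student I a b c"
    using M unfolding student_optimal_stable_def by blast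
  have e: "(a, b) \<in> envy I M" using ab rotation_pairs_envy[OF inst st rot] by blast
  then have "lt_student I a c b" "(a, b) \<in> edges I" "c \<noteq> b" "(a, c) \<in> edges I"
    using c(1) st by (auto simp: envy_def prefers_to_assigned_def stable_def assignment_def)
  then show False using c(2) student_asym[OF inst] by blast
qed

text \<open>An orbit in a finite set repeats; the least period makes the points of the cycle
  distinct, as \<open>school_rotation\<close> demands.\<close>

lemma finite_function_cycle:
  assumes "finite Y" and "Y \<noteq> {}" and closed: "\<And>y. y \<in> Y \<Longrightarrow> \<nu> y \<in> Y"
  obtains c n where "c \<in> Y" "0 < n" "(\<nu> ^^ n) c = c" "inj_on (\<lambda>i. (\<nu> ^^ i) c) {..<n}"
proof -
  obtain y where y: "y \<in> Y" using assms(2) by blast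
  have orbit: "(\<nu> ^^ i) y \<in> Y" for i
    by (induction i) (use y closed in auto)
  have "\<not> inj (\<lambda>i. (\<nu> ^^ i) y)"
    using assms(1) orbit by (meson finite_subset finite_imageD image_subsetI infinite_UNIV_nat)
  then obtain i j where ij: "i < j" "(\<nu> ^^ i) y = (\<nu> ^^ j) y"
    unfolding inj_def by (metis linorder_neqE_nat)
  define c where "c = (\<nu> ^^ i) y"
  have "(\<nu> ^^ (j - i)) c = (\<nu> ^^ (j - i + i)) y" by (simp only: c_def funpow_add o_apply)
  also have "\<dots> = c" using ij by (simp add: c_def)
  finally have ex: "\<exists>n. 0 < n \<and> (\<nu> ^^ n) c = c" using ij(1) by (intro exI[of _ "j - i"]) simp
  define n where "n = (LEAST n. 0 < n \<and> (\<nu> ^^ n) c = c)"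
  have n: "0 < n" "(\<nu> ^^ n) c = c" using LeastI_ex[OF ex] by (auto simp: n_def)
  have least: "n \<le> m" if "0 < m" "(\<nu> ^^ m) c = c" for m
    unfolding n_def by (rule Least_le) (use that in simp)
  have "False" if ij: "i < j" "j < n" "(\<nu> ^^ i) c = (\<nu> ^^ j) c" for i j
  proof -
    have "(\<nu> ^^ (n - j + i)) c = (\<nu> ^^ (n - j)) ((\<nu> ^^ j) c)"
      using ij(3) by (simp add: funpow_add)
    also have "\<dots> = (\<nu> ^^ (n - j + j)) c" by (simp only: funpow_add o_apply)
    also have "\<dots> = c" using ij(2) n(2) by simp
    finally show False using least[of "n - j + i"] ij by simp
  qed
  then have "inj_on (\<lambda>i. (\<nu> ^^ i) c) {..<n}"
    by (intro inj_onI) (metis lessThan_iff linorder_neqE_nat)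
  moreover have "c \<in> Y" using orbit by (simp add: c_def)
  ultimately show ?thesis using that n by blast
qed

lemma school_rotation_exists:
  assumes inst: "stable_assignment_instance I" and asg: "assignment I M"
    and "finite Y" and "Y \<noteq> {}"
    and closed: "\<And>b. b \<in> Y \<Longrightarrow> \<exists>a c. is_s I M b a \<and> (a, c) \<in> M \<and> c \<in> Y"
  shows "\<exists>\<rho>. school_rotation I M \<rho>"
proof -
  obtain \<sigma> \<nu> where s: "\<And>b. b \<in> Y \<Longrightarrow> is_s I M b (\<sigma> b)"
    and m: "\<And>b. b \<in> Y \<Longrightarrow> (\<sigma> b, \<nu> b) \<in> M" and c: "\<And>b. b \<in> Y \<Longrightarrow> \<nu> b \<in> Y"
    using closed by metis
  obtain b n where b: "b \<in> Y" and n: "0 < n" "(\<nu> ^^ n) b = b"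
    and inj: "inj_on (\<lambda>i. (\<nu> ^^ i) b) {..<n}"
    using finite_function_cycle[of Y \<nu>] assms(3,4) c by blast
  have Y: "(\<nu> ^^ i) b \<in> Y" for i
    by (induction i) (use b c in auto)
  have shift: "(\<nu> ^^ (n + i)) b = (\<nu> ^^ i) b" for i
    using n(2) by (simp add: add.commute[of n] funpow_add)
  \<comment> \<open>The student at position \<open>i\<close> is the one the preceding school points
    at; \<open>n - 1 + i\<close> stands for the index i - 1 modulo the period, without subtracting
    below zero.\<close>
  define \<rho> where "\<rho> = map (\<lambda>i. (\<sigma> ((\<nu> ^^ (n - 1 + i)) b), (\<nu> ^^ i) b)) [0..<n]"
  have len: "length \<rho> = n" by (simp add: \<rho>_def)
  have nth: "\<rho> ! i = (\<sigma> ((\<nu> ^^ (n - 1 + i)) b), (\<nu> ^^ i) b)" if "i < n" for i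
    using that by (simp add: \<rho>_def)
  have "set \<rho> \<subseteq> M"
  proof
    fix x assume "x \<in> set \<rho>"
    then obtain i where x: "x = (\<sigma> ((\<nu> ^^ (n - 1 + i)) b), (\<nu> ^^ i) b)" by (auto simp: \<rho>_def)
    have "\<nu> ((\<nu> ^^ (n - 1 + i)) b) = (\<nu> ^^ Suc (n - 1 + i)) b" by simp
    also have "\<dots> = (\<nu> ^^ (n + i)) b" using n(1) by simp
    also have "\<dots> = (\<nu> ^^ i) b" by (rule shift)
    finally show "x \<in> M" using m[OF Y[of "n - 1 + i"]] x by simp
  qed
  moreover have "distinct (map snd \<rho>)"
    using inj by (simp add: \<rho>_def distinct_map comp_def lessThan_atLeast0)
  moreover have "distinct (map fst \<rho>)"
  proof -
    have "inj_on fst (set \<rho>)"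
    proof (rule inj_onI)
      fix x y assume xy: "x \<in> set \<rho>" "y \<in> set \<rho>" "fst x = fst y"
      obtain a c where x: "x = (a, c)" by (cases x)
      obtain d where y: "y = (a, d)" using xy(3) x by (cases y) simp
      have "(a, c) \<in> M" "(a, d) \<in> M" using xy(1,2) x y \<open>set \<rho> \<subseteq> M\<close> by blast+
      then show "x = y" using assignment_functional[OF inst asg, of a c d] x y by simp
    qed
    then show ?thesis using \<open>distinct (map snd \<rho>)\<close> by (simp add: distinct_map)
  qed
  moreover have "is_s I M d a" if da: "(a, d) \<in> rotation_pairs \<rho>" for a d
  proof -
    obtain i where i: "i < n" "a = fst (\<rho> ! (Suc i mod n))" "d = snd (\<rho> ! i)"
      using da by (auto simp: rotation_pairs_def len)
    have "a = \<sigma> ((\<nu> ^^ i) b)"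
    proof (cases "Suc i = n")
      case True
      then have "a = fst (\<rho> ! 0)" using i(2) by simp
      then show ?thesis using True nth[of 0] n(1) by auto
    next
      case False
      then have "Suc i < n" using i(1) by simp
      then have "a = \<sigma> ((\<nu> ^^ (n - 1 + Suc i)) b)" using i(2) nth by simp
      also have "n - 1 + Suc i = n + i" using n(1) by simp
      finally show ?thesis using shift by simp
    qed
    then show ?thesis using s[OF Y[of i]] i nth by simp
  qed
  moreover have "\<rho> \<noteq> []" using n(1) len by auto
  ultimately show ?thesis by (auto simp: school_rotation_iff)
qed

text \<open>The schools gaining a student from \<open>M\<close> to \<open>N\<close> are closed under
  following two arcs, so they contain a cycle. Closure needs that a school losing a student also
  gains one, and that students matched by \<open>N\<close> are matched by \<open>M\<close>; both
  come from a count as in the rural hospitals theorem.\<close>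

lemma non_optimal_rotation_exists:
  assumes inst: "stable_assignment_instance I" and M: "stable I M"
    and N: "student_optimal_stable I N" and ne: "M \<noteq> N"
  shows "\<exists>\<rho>. school_rotation I M \<rho>"
proof -
  have asg: "assignment I M" "assignment I N" and stN: "stable I N"
    using M N by (auto simp: student_optimal_stable_def stable_def)
  have sub: "M \<subseteq> edges I" "N \<subseteq> edges I" using asg by (auto simp: assignment_def)
  have fin: "finite M" "finite N"
    using sub instance_finite_edges[OF inst] finite_subset by blast+
  have dom: "\<exists>c. (a, c) \<in> N \<and> (c = b \<or> lt_student I a b c)" if "(a, b) \<in> M" for a b
    using N M that unfolding student_optimal_stable_def by blast
  have funM: "b = c" if "(a, b) \<in> M" "(a, c) \<in> M" for a b c
    using assignment_functional[OF inst asg(1)] that by blast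
  have funN: "b = c" if "(a, b) \<in> N" "(a, c) \<in> N" for a b c
    using assignment_functional[OF inst asg(2)] that by blast
  have gain: "(a, b) \<in> envy I M" if "(a, b) \<in> N - M" for a b
  proof -
    have "lt_student I a d b" if "(a, d) \<in> M" for d
      using dom[OF that] funN[of a b] \<open>(a, b) \<in> N - M\<close> that by blast
    then show ?thesis using that sub by (auto simp: envy_def prefers_to_assigned_def)
  qed
  define Y where "Y = snd ` (N - M)"
  have "Y \<noteq> {}"
  proof
    assume "Y = {}"
    then have "N \<subseteq> M" by (auto simp: Y_def)
    moreover have "M \<subseteq> N"
    proof clarify
      fix a b assume ab: "(a, b) \<in> M"
      obtain c where "(a, c) \<in> N" using dom[OF ab] by blast
      then show "(a, b) \<in> N" using funM[OF ab, of c] \<open>N \<subseteq> M\<close> by blast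
    qed
    ultimately show False using ne by blast
  qed
  \<comment> \<open>A school that gains a student is envied under \<open>M\<close>, hence full
    there; any other school can only lose students.\<close>
  have card_le: "card (N\<inverse> `` {b}) \<le> card (M\<inverse> `` {b})" for b
  proof (cases "b \<in> Y")
    case True
    then obtain a where "(a, b) \<in> N - M" by (auto simp: Y_def)
    then show ?thesis
      using stable_envyD(1)[OF inst M gain] assignment_card_le[OF inst asg(2), of b] by simp
  next
    case False
    then have "(a, b) \<notin> N - M" for a by (force simp: Y_def)
    then show ?thesis by (intro card_mono finite_students_of fin) blast
  qed
  have card_sum: "card X = (\<Sum>b\<in>schools I. card (X\<inverse> `` {b}))" if X: "X \<subseteq> edges I" "finite X" for X
  proof -
    have fs: "finite (schools I)" using inst by (simp add: stable_assignment_instance_def)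
    have "X\<inverse> = Sigma (schools I) (\<lambda>b. X\<inverse> `` {b})"
      using X(1) inst by (auto simp: stable_assignment_instance_def)
    then have "card (X\<inverse>) = (\<Sum>b\<in>schools I. card (X\<inverse> `` {b}))"
      using card_SigmaI[OF fs, of "\<lambda>b. X\<inverse> `` {b}"] finite_students_of[OF X(2)] by simp
    then show ?thesis by simp
  qed
  \<comment> \<open>\<open>N\<close> matches every student matched by \<open>M\<close>, yet the
    school counts say that it matches at most as many. So the totals, the sets of matched students
    and all school counts agree.\<close>
  have img: "fst ` M \<subseteq> fst ` N" using dom by force
  have inj: "inj_on fst M" "inj_on fst N"
    using funM funN by (auto intro!: inj_onI)
  have "card M = card (fst ` M)" "card N = card (fst ` N)" using inj by (simp_all add: card_image)
  then have "card M \<le> card N" using card_mono[OF _ img] fin by simp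
  moreover have "card N \<le> card M"
    unfolding card_sum[OF sub(1) fin(1)] card_sum[OF sub(2) fin(2)] by (rule sum_mono) (rule card_le)
  ultimately have eq: "card M = card N" by simp
  then have matched: "fst ` M = fst ` N"
    using card_subset_eq[OF _ img] fin \<open>card M = card (fst ` M)\<close> \<open>card N = card (fst ` N)\<close> by simp
  have card_eq: "card (N\<inverse> `` {b}) = card (M\<inverse> `` {b})" for b
  proof (cases "b \<in> schools I")
    case True
    show ?thesis
    proof (rule ccontr)
      assume "\<not> ?thesis"
      then have "card (N\<inverse> `` {b}) < card (M\<inverse> `` {b})" using card_le[of b] by simp
      moreover have "finite (schools I)" using inst by (simp add: stable_assignment_instance_def)
      ultimately have "card N < card M"
        using sum_strict_mono_ex1[of "schools I" "\<lambda>b. card (N\<inverse> `` {b})" "\<lambda>b. card (M\<inverse> `` {b})"]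
          card_le True card_sum[OF sub(1) fin(1)] card_sum[OF sub(2) fin(2)] by auto
      then show False using eq by simp
    qed
  next
    case False
    then have "N\<inverse> `` {b} = {}" "M\<inverse> `` {b} = {}"
      using sub inst by (auto simp: stable_assignment_instance_def)
    then show ?thesis by simp
  qed
  have "\<exists>x c. is_s I M b x \<and> (x, c) \<in> M \<and> c \<in> Y" if "b \<in> Y" for b
  proof -
    obtain a where a: "(a, b) \<in> N - M" using \<open>b \<in> Y\<close> by (auto simp: Y_def)
    obtain x where x: "is_s I M b x" using is_s_exists[OF inst gain[OF a]] by blast
    then have xe: "(x, b) \<in> envy I M" by (simp add: is_s_iff)
    \<comment> \<open>If \<open>x\<close> gained no school, then \<open>x\<close> would still prefer
      \<open>b\<close> under \<open>N\<close>, where \<open>b\<close> took the lower-ranked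
      \<open>a\<close>: a blocking pair.\<close>
    have "\<exists>d. (x, d) \<in> N - M"
    proof (rule ccontr)
      assume no: "\<nexists>d. (x, d) \<in> N - M"
      then have "x \<noteq> a" using a by blast
      then have "lt_school I b a x" using x gain[OF a] by (auto simp: is_s_iff)
      moreover have "prefers_to_assigned I N x b"
        using no xe by (auto simp: envy_def prefers_to_assigned_def)
      ultimately have "blocks I N x b" using a xe envy_subset by (auto simp: blocks_def)
      then show False using stN by (simp add: stable_def)
    qed
    then obtain d where d: "(x, d) \<in> N" "(x, d) \<notin> M" by blast
    have "x \<in> fst ` M" using d(1) matched by force
    then obtain c where c: "(x, c) \<in> M" by force
    have "(x, c) \<notin> N" using d c funN[of x c d] by blast
    have "\<not> N\<inverse> `` {c} \<subseteq> M\<inverse> `` {c}"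
    proof
      assume "N\<inverse> `` {c} \<subseteq> M\<inverse> `` {c}"
      then have "N\<inverse> `` {c} = M\<inverse> `` {c}"
        using card_subset_eq[OF finite_students_of[OF fin(1)]] card_eq by blast
      then show False using c \<open>(x, c) \<notin> N\<close> by blast
    qed
    then obtain y where "(y, c) \<in> N - M" by blast
    then have "c \<in> Y" unfolding Y_def by force
    then show ?thesis using x c by blast
  qed
  moreover have "finite Y" using fin by (simp add: Y_def)
  ultimately show ?thesis
    using school_rotation_exists[OF inst asg(1) _ \<open>Y \<noteq> {}\<close>] by blast
qed

section \<open>Confluence of school-rotate-remove\<close>

definition srr_state :: "('a, 'b) assignment_instance \<times> ('a \<times> 'b) set \<Rightarrow> bool" where
  "srr_state s \<longleftrightarrow> stable_assignment_instance (fst s) \<and> stable (fst s) (snd s)"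

lemma is_s_antimono:
  assumes "is_s I M b a" and "envy J N \<subseteq> envy I M" and "(a, b) \<in> envy J N"
    and "lt_school J = lt_school I"
  shows "is_s J N b a"
  using assms unfolding is_s_iff by auto

lemma removable_delete:
  assumes "removable I M a b" and "(a, b) \<notin> X"
  shows "removable (I\<lparr>edges := edges I - X\<rparr>) M a b"
proof -
  have "is_s (I\<lparr>edges := edges I - X\<rparr>) M b a"
    by (rule is_s_antimono[of I M]) (use assms in \<open>auto simp: removable_def is_s_iff envy_delete\<close>)
  then show ?thesis using assms(1) by (simp add: removable_def envy_delete)
qed

lemma delete_delete:
  "I\<lparr>edges := edges I - X\<rparr>\<lparr>edges := edges (I\<lparr>edges := edges I - X\<rparr>) - Y\<rparr>
     = I\<lparr>edges := edges I - (X \<union> Y)\<rparr>"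
  by (simp add: Diff_eq Int_assoc)

text \<open>The school of \<open>a\<close>, if any, is a sink while schools on a rotation are
  envied, so \<open>a\<close> is off the rotation; so is \<open>b\<close>, since it points only at
  \<open>a\<close>.\<close>

lemma removable_rotation_commute:
  assumes inst: "stable_assignment_instance I" and M: "stable I M"
    and rem: "removable I M a b" and rot: "school_rotation I M \<rho>"
  shows "removable I (apply_rotation M \<rho>) a b"
    and "school_rotation (I\<lparr>edges := edges I - removed_edges C I a b\<rparr>) M \<rho>"
proof -
  have s: "is_s I M b a" using rem by (simp add: removable_def)
  have aA: "a \<notin> fst ` set \<rho>"
  proof
    assume "a \<in> fst ` set \<rho>"
    then obtain c where c: "(a, c) \<in> set \<rho>" by force
    then have "(a, c) \<in> M" using rot by (auto simp: school_rotation_iff)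
    moreover obtain x where "(x, c) \<in> rotation_pairs \<rho>"
      using c rotation_pairs_schools[of \<rho>] by force
    ultimately show False
      using rem rotation_pairs_envy[OF inst M rot] by (auto simp: removable_def)
  qed
  have bB: "(x, b) \<notin> rotation_pairs \<rho>" for x
  proof
    assume x: "(x, b) \<in> rotation_pairs \<rho>"
    then have "x = a" using is_s_unique[OF inst s] rotation_pairs_is_s[OF inst M rot] by blast
    then show False using x aA rotation_pairs_students[of \<rho>] by force
  qed
  have env: "envy I (apply_rotation M \<rho>) \<subseteq> envy I M"
    using envy_apply_rotation[OF inst M rot] by blast
  have "(a, b) \<in> envy I (apply_rotation M \<rho>)"
    using envy_apply_rotation_outside[OF inst M rot aA] s by (simp add: is_s_iff)
  then have "is_s I (apply_rotation M \<rho>) b a" using is_s_antimono[OF s env] by simp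
  moreover have "(x, c) \<notin> envy I (apply_rotation M \<rho>)" if "(a, c) \<in> apply_rotation M \<rho>" for x c
    using that aA env rem by (auto simp: mem_apply_rotation[OF inst M rot] removable_def)
  ultimately show "removable I (apply_rotation M \<rho>) a b" by (simp add: removable_def)
  have "is_s (I\<lparr>edges := edges I - removed_edges C I a b\<rparr>) M d x"
    if x: "(x, d) \<in> rotation_pairs \<rho>" for x d
  proof (rule is_s_antimono[of I M])
    show "is_s I M d x" using rotation_pairs_is_s[OF inst M rot x] .
    have "d \<noteq> b" using x bB by blast
    then have "(x, d) \<notin> removed_edges C I a b" using removed_edges_school by fast
    then show "(x, d) \<in> envy (I\<lparr>edges := edges I - removed_edges C I a b\<rparr>) M"
      using rotation_pairs_envy[OF inst M rot] x by (auto simp: envy_delete)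
  qed (auto simp: envy_delete)
  then show "school_rotation (I\<lparr>edges := edges I - removed_edges C I a b\<rparr>) M \<rho>"
    using rot by (auto simp: school_rotation_iff)
qed

text \<open>From a shared student both cycles continue through the same school and its unique arc,
  so one turn around \<open>\<rho>\<close> never leaves \<open>\<tau>\<close>.\<close>

lemma rotation_students_subset:
  assumes inst: "stable_assignment_instance I" and M: "stable I M"
    and \<rho>: "school_rotation I M \<rho>" and \<tau>: "school_rotation I M \<tau>"
    and meet: "fst ` set \<rho> \<inter> fst ` set \<tau> \<noteq> {}"
  shows "fst ` set \<rho> \<subseteq> fst ` set \<tau>"
proof -
  let ?r = "length \<rho>"
  have step: "fst (\<rho> ! (Suc i mod ?r)) \<in> fst ` set \<tau>" if i: "i < ?r" "fst (\<rho> ! i) \<in> fst ` set \<tau>" for i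
  proof -
    have "(fst (\<rho> ! i), snd (\<rho> ! i)) \<in> M"
      using \<rho> nth_mem[OF i(1)] by (auto simp: school_rotation_iff)
    then have "(fst (\<rho> ! i), snd (\<rho> ! i)) \<in> set \<tau>" using rotation_mem_iff[OF inst M \<tau>] i(2) by blast
    then have "snd (\<rho> ! i) \<in> snd ` rotation_pairs \<tau>" by (simp only: rotation_pairs_schools) force
    then obtain x where x: "(x, snd (\<rho> ! i)) \<in> rotation_pairs \<tau>" by force
    have "(fst (\<rho> ! (Suc i mod ?r)), snd (\<rho> ! i)) \<in> rotation_pairs \<rho>"
      using i(1) by (auto simp: rotation_pairs_def)
    then have "x = fst (\<rho> ! (Suc i mod ?r))"
      using is_s_unique[OF inst] rotation_pairs_is_s[OF inst M \<rho>] rotation_pairs_is_s[OF inst M \<tau> x]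
      by blast
    then show ?thesis using imageI[OF x, of fst] by (simp add: rotation_pairs_students)
  qed
  obtain i where i: "i < ?r" "fst (\<rho> ! i) \<in> fst ` set \<tau>"
  proof -
    obtain x where x: "x \<in> set \<rho>" "fst x \<in> fst ` set \<tau>" using meet by blast
    then show ?thesis using that by (metis in_set_conv_nth)
  qed
  have all: "fst (\<rho> ! ((i + k) mod ?r)) \<in> fst ` set \<tau>" for k
  proof (induction k)
    case 0
    then show ?case using i by simp
  next
    case (Suc k)
    have "(i + k) mod ?r < ?r" using i(1) by (intro mod_less_divisor) linarith
    then show ?case using step[of "(i + k) mod ?r"] Suc by (simp add: mod_Suc_eq)
  qed
  show ?thesis
  proof
    fix a assume "a \<in> fst ` set \<rho>"
    then obtain j where j: "j < ?r" "a = fst (\<rho> ! j)" by (auto simp: in_set_conv_nth)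
    have "(i + (?r - i + j)) mod ?r = j" using i(1) j(1) by simp
    then show "a \<in> fst ` set \<tau>" using all[of "?r - i + j"] j(2) by metis
  qed
qed

lemma rotations_commute:
  assumes inst: "stable_assignment_instance I" and M: "stable I M"
    and \<rho>: "school_rotation I M \<rho>" and \<tau>: "school_rotation I M \<tau>"
    and disj: "fst ` set \<rho> \<inter> fst ` set \<tau> = {}"
  shows "school_rotation I (apply_rotation M \<rho>) \<tau>"
    and "apply_rotation (apply_rotation M \<rho>) \<tau> = apply_rotation (apply_rotation M \<tau>) \<rho>"
proof -
  have out: "a \<notin> fst ` set \<rho>" if "(a, b) \<in> set \<tau> \<union> rotation_pairs \<tau>" for a b
  proof -
    have "a \<in> fst ` set \<tau>"
      using that imageI[of "(a, b)" "rotation_pairs \<tau>" fst] imageI[of "(a, b)" "set \<tau>" fst]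
      by (auto simp only: rotation_pairs_students fst_conv)
    then show ?thesis using disj by blast
  qed
  have out': "a \<notin> fst ` set \<tau>" if "(a, b) \<in> set \<rho> \<union> rotation_pairs \<rho>" for a b
  proof -
    have "a \<in> fst ` set \<rho>"
      using that imageI[of "(a, b)" "rotation_pairs \<rho>" fst] imageI[of "(a, b)" "set \<rho>" fst]
      by (auto simp only: rotation_pairs_students fst_conv)
    then show ?thesis using disj by blast
  qed
  have env: "envy I (apply_rotation M \<rho>) \<subseteq> envy I M"
    using envy_apply_rotation[OF inst M \<rho>] by blast
  have "is_s I (apply_rotation M \<rho>) b a" if ab: "(a, b) \<in> rotation_pairs \<tau>" for a b
  proof -
    have "a \<notin> fst ` set \<rho>" using out[of a b] ab by blast
    then have "(a, b) \<in> envy I (apply_rotation M \<rho>)"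
      using envy_apply_rotation_outside[OF inst M \<rho>] rotation_pairs_envy[OF inst M \<tau>] ab by blast
    then show ?thesis
      using is_s_antimono[OF rotation_pairs_is_s[OF inst M \<tau> ab] env] by simp
  qed
  moreover have "set \<tau> \<subseteq> apply_rotation M \<rho>"
  proof clarify
    fix a b assume ab: "(a, b) \<in> set \<tau>"
    then have "(a, b) \<in> M" "a \<notin> fst ` set \<rho>"
      using \<tau> out[of a b] by (auto simp only: school_rotation_iff)
    then show "(a, b) \<in> apply_rotation M \<rho>" by (simp add: mem_apply_rotation[OF inst M \<rho>])
  qed
  ultimately show "school_rotation I (apply_rotation M \<rho>) \<tau>"
    using \<tau> by (auto simp: school_rotation_iff)
  have "(a, b) \<notin> rotation_pairs \<rho> \<inter> set \<tau>" "(a, b) \<notin> rotation_pairs \<tau> \<inter> set \<rho>" for a b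
    using out[of a b] out'[of a b] imageI[of "(a, b)" "set \<tau>" fst] imageI[of "(a, b)" "set \<rho>" fst]
    by auto
  then have "rotation_pairs \<rho> \<inter> set \<tau> = {}" "rotation_pairs \<tau> \<inter> set \<rho> = {}" by auto
  then show "apply_rotation (apply_rotation M \<rho>) \<tau> = apply_rotation (apply_rotation M \<tau>) \<rho>"
    by (auto simp: apply_rotation_eq)
qed

text \<open>Meeting cycles coincide up to the starting point, which \<open>apply_rotation\<close>
  does not see.\<close>

lemma meeting_rotations_agree:
  assumes inst: "stable_assignment_instance I" and M: "stable I M"
    and \<rho>: "school_rotation I M \<rho>" and \<tau>: "school_rotation I M \<tau>"
    and meet: "fst ` set \<rho> \<inter> fst ` set \<tau> \<noteq> {}"
  shows "apply_rotation M \<rho> = apply_rotation M \<tau>"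
proof -
  have st: "fst ` set \<rho> = fst ` set \<tau>"
    using rotation_students_subset[OF inst M \<rho> \<tau>] rotation_students_subset[OF inst M \<tau> \<rho>] meet
    by blast
  have "(a, b) \<in> set \<rho> \<longleftrightarrow> (a, b) \<in> set \<tau>" for a b
    using rotation_mem_iff[OF inst M \<rho>, of a b] rotation_mem_iff[OF inst M \<tau>, of a b] st \<rho> \<tau>
    by (auto simp: school_rotation_iff)
  then have eq: "set \<rho> = set \<tau>" by auto
  have sub: "rotation_pairs \<rho>' \<subseteq> rotation_pairs \<tau>'"
    if "school_rotation I M \<rho>'" "school_rotation I M \<tau>'" "set \<rho>' = set \<tau>'" for \<rho>' \<tau>'
  proof clarify
    fix a b assume ab: "(a, b) \<in> rotation_pairs \<rho>'"
    then have "b \<in> snd ` rotation_pairs \<tau>'"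
      using rotation_pairs_schools[of \<rho>'] rotation_pairs_schools[of \<tau>'] that(3) by force
    then obtain x where x: "(x, b) \<in> rotation_pairs \<tau>'" by force
    then have "x = a"
      using ab is_s_unique[OF inst] rotation_pairs_is_s[OF inst M that(1)]
        rotation_pairs_is_s[OF inst M that(2)] by blast
    then show "(a, b) \<in> rotation_pairs \<tau>'" using x by simp
  qed
  have "rotation_pairs \<rho> = rotation_pairs \<tau>" using sub[OF \<rho> \<tau> eq] sub[OF \<tau> \<rho>] eq by blast
  then show ?thesis using eq by (simp add: apply_rotation_eq)
qed

section \<open>Commuting iterations and the invariance of results\<close>

lemma srr_step_state:
  assumes "srr_state s" and "srr_step C s s'"
  shows "srr_state s'"
proof -
  obtain I M where s: "s = (I, M)" by (cases s)
  have inst: "stable_assignment_instance I" and M: "stable I M"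
    using assms(1) by (auto simp: s srr_state_def)
  then have asg: "assignment I M" by (simp add: stable_def)
  show ?thesis
    using inst asg assms(2)[unfolded s]
  proof (cases rule: srr_stepE)
    case (remove a b)
    then have "M \<inter> removed_edges C I a b = {}"
      using removed_edges_disjoint[OF inst M] by (simp add: removable_def)
    then show ?thesis
      using remove stable_delete_edges[OF M] instance_delete_edges[OF inst] by (simp add: srr_state_def)
  next
    case (rotate \<rho>)
    then show ?thesis using apply_rotation_stable[OF inst M] inst by (simp add: srr_state_def)
  qed
qed

lemma srr_steps_state: "(srr_step C)\<^sup>*\<^sup>* s s' \<Longrightarrow> srr_state s \<Longrightarrow> srr_state s'"
  by (induction rule: rtranclp_induct) (auto intro: srr_step_state)

lemma srr_diamond:
  assumes st: "srr_state s" and s1: "srr_step C s s1" and s2: "srr_step C s s2"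
  shows "s1 = s2 \<or> (\<exists>t. srr_step C s1 t \<and> srr_step C s2 t)"
proof -
  obtain I M where s: "s = (I, M)" by (cases s)
  have inst: "stable_assignment_instance I" and M: "stable I M"
    using st by (auto simp: s srr_state_def)
  then have asg: "assignment I M" by (simp add: stable_def)
  let ?del = "\<lambda>a b. I\<lparr>edges := edges I - removed_edges C I a b\<rparr>"
  have mixed: "\<exists>t. srr_step C (?del a b, M) t \<and> srr_step C (I, apply_rotation M \<rho>) t"
    if "removable I M a b" "school_rotation I M \<rho>" for a b \<rho>
    using removable_step[OF removable_rotation_commute(1)[OF inst M that], of C]
      srr_rotate[OF removable_rotation_commute(2)[OF inst M that, of C], of C] by blast
  show ?thesis
    using inst asg s1[unfolded s]
  proof (cases rule: srr_stepE)
    case r1: (remove a b)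
    show ?thesis
      using inst asg s2[unfolded s]
    proof (cases rule: srr_stepE)
      case r2: (remove a' b')
      show ?thesis
      proof (cases "b = b'")
        case True
        then have "a = a'" using r1 r2 is_s_unique[OF inst] by (auto simp: removable_def)
        then show ?thesis using r1 r2 True by simp
      next
        case False
        have "removable (?del a b) M a' b'" "removable (?del a' b') M a b"
          using False r1(1) r2(1) by (auto intro!: removable_delete dest: removed_edges_school)
        from this[THEN removable_step, of C] show ?thesis
          unfolding r1(2) r2(2) delete_delete removed_edges_delete by (metis Un_commute)
      qed
    next
      case (rotate \<rho>)
      then show ?thesis using mixed[OF r1(1)] r1(2) by blast
    qed
  next
    case r1: (rotate \<rho>)
    show ?thesis
      using inst asg s2[unfolded s]
    proof (cases rule: srr_stepE)
      case (remove a b)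
      then show ?thesis using mixed[OF _ r1(1)] r1(2) by blast
    next
      case r2: (rotate \<tau>)
      show ?thesis
      proof (cases "fst ` set \<rho> \<inter> fst ` set \<tau> = {}")
        case True
        show ?thesis
          using srr_rotate[OF rotations_commute(1)[OF inst M r1(1) r2(1) True], of C]
            srr_rotate[OF rotations_commute(1)[OF inst M r2(1) r1(1)], of C]
            rotations_commute(2)[OF inst M r1(1) r2(1) True] True r1(2) r2(2) by (metis Int_commute)
      next
        case False
        then show ?thesis using meeting_rotations_agree[OF inst M r1(1) r2(1)] r1(2) r2(2) by blast
      qed
    qed
  qed
qed

lemma srr_confluent:
  assumes "srr_state s" and "(srr_step C)\<^sup>*\<^sup>* s t" and "(srr_step C)\<^sup>*\<^sup>* s u"
  shows "\<exists>v. (srr_step C)\<^sup>*\<^sup>* t v \<and> (srr_step C)\<^sup>*\<^sup>* u v"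
proof -
  \<comment> \<open>The diamond property is available only for valid instances with stable
    assignments, so the relation is restricted to these before the abstract theorem is
    applied.\<close>
  let ?r = "\<lambda>x y. srr_state x \<and> srr_step C x y"
  have "strong_confluentp ?r"
  proof
    fix x y z assume "?r x y" "?r x z"
    then have "y = z \<or> (\<exists>t. srr_step C y t \<and> srr_step C z t)" "srr_state y" "srr_state z"
      using srr_diamond srr_step_state by blast+
    then show "\<exists>u. ?r\<^sup>*\<^sup>* y u \<and> ?r\<^sup>=\<^sup>= z u" by blast
  qed
  then have conf: "confluentp ?r" by (rule strong_confluentp_imp_confluentp)
  have lift: "?r\<^sup>*\<^sup>* s x" if "(srr_step C)\<^sup>*\<^sup>* s x" for x
    using that
  proof (induction rule: rtranclp_induct)
    case (step y z)
    then have "?r y z" using srr_steps_state assms(1) by blast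
    then show ?case using step.IH by (rule rtranclp.rtrancl_into_rtrancl[rotated])
  qed simp
  have unlift: "?r\<^sup>*\<^sup>* x y \<Longrightarrow> (srr_step C)\<^sup>*\<^sup>* x y" for x y
    by (erule rtranclp_mono[THEN predicate2D, rotated]) blast
  from confluentpD[OF conf lift[OF assms(2)] lift[OF assms(3)]] show ?thesis
    using unlift by blast
qed

definition srr_results ::
    "'a set \<Rightarrow> ('a, 'b) assignment_instance \<times> ('a \<times> 'b) set \<Rightarrow> ('a \<times> 'b) set set" where
  "srr_results C s = {M. \<exists>J. (srr_step C)\<^sup>*\<^sup>* s (J, M) \<and> school_rotation_digraph J M = {}}"

lemma srr_terminal:
  assumes "school_rotation_digraph J M = {}"
  shows "\<not> srr_step C (J, M) s"
proof
  assume "srr_step C (J, M) s"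
  then show False
    by cases (use assms in \<open>auto simp: school_rotation_def\<close>)
qed

text \<open>A result admits no further step, so its common reduct with \<open>t\<close>, given by
  confluence, is that result itself.\<close>

lemma srr_results_steps:
  assumes "srr_state s" and "(srr_step C)\<^sup>*\<^sup>* s t"
  shows "srr_results C s = srr_results C t"
proof
  show "srr_results C t \<subseteq> srr_results C s"
    using assms(2) by (auto simp: srr_results_def intro: rtranclp_trans)
  show "srr_results C s \<subseteq> srr_results C t"
  proof
    fix M assume "M \<in> srr_results C s"
    then obtain J where J: "(srr_step C)\<^sup>*\<^sup>* s (J, M)" "school_rotation_digraph J M = {}"
      by (auto simp: srr_results_def)
    then obtain v where v: "(srr_step C)\<^sup>*\<^sup>* t v" "(srr_step C)\<^sup>*\<^sup>* (J, M) v"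
      using srr_confluent[OF assms] by blast
    have "v = (J, M)" using v(2) srr_terminal[OF J(2)] by (metis converse_rtranclpE)
    then show "M \<in> srr_results C t" using v(1) J(2) by (auto simp: srr_results_def)
  qed
qed

section \<open>Termination and progress of school-rotate-remove\<close>

definition srr_size :: "('a, 'b) assignment_instance \<times> ('a \<times> 'b) set \<Rightarrow> nat" where
  "srr_size s = card (edges (fst s)) + card (envy (fst s) (snd s))"

text \<open>A removal lowers the number of edges and a rotation the amount of envy; neither raises
  the other summand.\<close>

lemma srr_step_size:
  assumes "srr_state s" and "srr_step C s s'"
  shows "srr_size s' < srr_size s"
proof -
  obtain I M where s: "s = (I, M)" by (cases s)
  have inst: "stable_assignment_instance I" and M: "stable I M"
    using assms(1) by (auto simp: s srr_state_def)
  then have asg: "assignment I M" by (simp add: stable_def)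
  have fin: "finite (edges I)" "finite (envy I M)"
    using instance_finite_edges[OF inst] finite_subset[OF envy_subset] by blast+
  show ?thesis
    using inst asg assms(2)[unfolded s]
  proof (cases rule: srr_stepE)
    case (remove a b)
    have "(a, b) \<in> edges I" using remove(1) envy_subset by (auto simp: removable_def is_s_iff)
    then have "card (edges I - removed_edges C I a b) < card (edges I)"
      using removed_edges_self[of a b C I] by (intro psubset_card_mono fin) blast
    moreover have "card (envy I M - removed_edges C I a b) \<le> card (envy I M)"
      by (intro card_mono fin) blast
    ultimately show ?thesis using remove(2) by (simp add: s srr_size_def envy_delete)
  next
    case (rotate \<rho>)
    then show ?thesis
      using psubset_card_mono[OF fin(2) envy_apply_rotation[OF inst M rotate(1)]]
      by (simp add: s srr_size_def)
  qed
qed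

text \<open>If nothing is removable, every envied school points at a student assigned to an envied
  school, so the envied schools contain a cycle.\<close>

lemma srr_progress:
  assumes "srr_state (I, M)" and "school_rotation_digraph I M \<noteq> {}"
  shows "\<exists>s. srr_step C (I, M) s"
proof (cases "\<exists>a b. removable I M a b")
  case True
  then obtain a b where "removable I M a b" by blast
  then show ?thesis using removable_step[of I M a b C] by blast
next
  case False
  have inst: "stable_assignment_instance I" and M: "stable I M"
    using assms(1) by (auto simp: srr_state_def)
  have asg: "assignment I M" using M by (simp add: stable_def)
  let ?Y = "snd ` envy I M"
  have "finite ?Y" using finite_subset[OF envy_subset instance_finite_edges[OF inst]] by blast
  moreover have "?Y \<noteq> {}" using assms(2) digraph_empty_iff[OF inst] by blast
  moreover have "\<exists>a c. is_s I M b a \<and> (a, c) \<in> M \<and> c \<in> ?Y" if "b \<in> ?Y" for b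
  proof -
    obtain a where a: "is_s I M b a" using \<open>b \<in> ?Y\<close> is_s_exists[OF inst] by force
    then obtain c x where "(a, c) \<in> M" "(x, c) \<in> envy I M" using False by (auto simp: removable_def)
    then show ?thesis using a by force
  qed
  ultimately obtain \<rho> where "school_rotation I M \<rho>"
    using school_rotation_exists[OF inst asg] by blast
  then show ?thesis using srr_rotate by blast
qed

lemma srr_results_nonempty:
  assumes "srr_state s"
  shows "srr_results C s \<noteq> {}"
  using assms
proof (induction "srr_size s" arbitrary: s rule: less_induct)
  case less
  obtain I M where s: "s = (I, M)" by (cases s)
  show ?case
  proof (cases "school_rotation_digraph I M = {}")
    case True
    then have "M \<in> srr_results C s" by (auto simp: srr_results_def s)
    then show ?thesis by blast
  next
    case False
    then obtain t where t: "srr_step C s t" using srr_progress less.prems s by blast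
    then have "srr_results C t \<noteq> {}"
      using less.hyps[of t] srr_step_size[OF less.prems t] srr_step_state[OF less.prems t] by blast
    then show ?thesis using srr_results_steps[OF less.prems r_into_rtranclp[of "srr_step C", OF t]] by simp
  qed
qed

lemma srr_reaches_optimal:
  assumes "stable_assignment_instance I" and "stable I M"
  shows "(srr_step C)\<^sup>*\<^sup>* (I, M) (I, gs_output I)"
  using assms(2)
proof (induction "card (envy I M)" arbitrary: M rule: less_induct)
  case less
  show ?case
  proof (cases "M = gs_output I")
    case False
    then obtain \<rho> where \<rho>: "school_rotation I M \<rho>"
      using non_optimal_rotation_exists[OF assms(1) less.prems gs_output_optimal[OF assms(1)]] by blast
    have "finite (envy I M)"
      using finite_subset[OF envy_subset instance_finite_edges[OF assms(1)]] .
    then have "card (envy I (apply_rotation M \<rho>)) < card (envy I M)"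
      using psubset_card_mono envy_apply_rotation[OF assms(1) less.prems \<rho>] by blast
    then have "(srr_step C)\<^sup>*\<^sup>* (I, apply_rotation M \<rho>) (I, gs_output I)"
      using less.hyps apply_rotation_stable[OF assms(1) less.prems \<rho>] by blast
    then show ?thesis
      using srr_rotate[OF \<rho>] by (rule converse_rtranclp_into_rtranclp[rotated])
  qed simp
qed

section \<open>One step of EADAM\<close>

text \<open>Let \<open>k\<close> be the step at which \<open>h\<close> is first held. If
  \<open>x\<close> was refused before \<open>k\<close>, the school was full already when
  \<open>h\<close> came in, so \<open>h\<close> displaced someone at step \<open>k\<close> itself,
  which the interval in the definition includes.\<close>

lemma refused_later_interrupting:
  assumes inst: "stable_assignment_instance I" and x: "(x, b) \<in> gs_refused I j"
    and h: "(h, b) \<in> gs_held I j" and "(h, b) \<in> gs_refused I m"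
  shows "\<exists>w>j. (h, b) \<in> interrupting_pairs I w"
proof -
  obtain w where w: "(h, b) \<in> gs_rejected I w"
    using gs_refusedE[OF inst assms(4)] by blast
  have "j < w"
  proof (rule ccontr)
    assume "\<not> j < w"
    then have "(h, b) \<in> gs_refused I j"
      using w gs_rejected_refused[OF inst] gs_refused_mono[OF inst, of w j] by auto
    then show False using h by (simp add: gs_refused_def)
  qed
  define k where "k = (LEAST k. (h, b) \<in> gs_held I k)"
  have k: "(h, b) \<in> gs_held I k" "k \<le> j" and least: "\<And>i. i < k \<Longrightarrow> (h, b) \<notin> gs_held I i"
    unfolding k_def using h by (auto intro: LeastI Least_le dest: not_less_Least)
  obtain t where t: "t \<le> j" "(x, b) \<in> gs_rejected I t"
    using gs_refusedE[OF inst x] by blast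
  have "\<exists>i\<in>{k..<w}. \<exists>a'. (a', b) \<in> gs_rejected I i"
  proof (cases "k \<le> t")
    case True
    then show ?thesis using t \<open>j < w\<close> by (intro bexI[of _ t] exI[of _ x]) auto
  next
    case False
    then obtain i where i: "k = Suc i" "t \<le> i" by (cases k) auto
    then have "(x, b) \<in> gs_refused I i" "(x, b) \<in> gs_refused I k"
      using t(2) gs_rejected_refused[OF inst, of t] gs_refused_mono[OF inst, of t i]
        gs_refused_mono[OF inst, of t k] by auto
    then have cards: "card ((gs_held I i)\<inverse> `` {b}) = card ((gs_held I k)\<inverse> `` {b})"
      using gs_refused_full[OF inst] by metis
    have "\<not> (gs_held I i)\<inverse> `` {b} \<subseteq> (gs_held I k)\<inverse> `` {b}"
    proof
      assume sub: "(gs_held I i)\<inverse> `` {b} \<subseteq> (gs_held I k)\<inverse> `` {b}"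
      have "finite ((gs_held I k)\<inverse> `` {b})"
        using gs_subset[of I k]
        by (intro finite_students_of finite_subset[OF _ instance_finite_edges[OF inst]]) blast
      then have "(gs_held I i)\<inverse> `` {b} = (gs_held I k)\<inverse> `` {b}"
        using card_subset_eq[OF _ sub cards] by blast
      then have "(h, b) \<in> gs_held I i" using k(1) by blast
      then show False using least i(1) by simp
    qed
    then obtain a' where "(a', b) \<in> gs_rejected I k" by (auto simp: i(1))
    then show ?thesis using k(2) \<open>j < w\<close> by (intro bexI[of _ k]) auto
  qed
  then have "(h, b) \<in> interrupting_pairs I w"
    using w k \<open>j < w\<close> by (auto simp: interrupting_pairs_def intro!: exI[of _ k])
  then show ?thesis using \<open>j < w\<close> by blast
qed

lemma consenting_pairs_envy:
  assumes "stable_assignment_instance I"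
  shows "consenting_pairs C I k \<subseteq> envy I (gs_output I)"
  using gs_rejected_refused[OF assms, of k]
  by (auto simp: consenting_pairs_def interrupting_pairs_def envy_gs_output[OF assms])

text \<open>
  Let \<open>J\<close> arise from \<open>I\<close> by exhaustive removals and write \<open>x\<^sub>b\<close> for the student with arc
  \<open>(b, x\<^sub>b)\<close> in the digraph of \<open>J\<close>.  Any student whom \<open>b\<close> loses after having rejected \<open>x\<^sub>b\<close> is a
  consenting interrupter, so from step \<open>k'\<close> on such a school holds its final students.  Were the
  latest rejection of some \<open>x\<^sub>b\<close> not before \<open>k'\<close>, the successor school \<open>M(x\<^sub>b)\<close> would already hold
  \<open>x\<^sub>b\<close> at that very step.  Hence \<open>b\<close> has rejected \<open>x\<^sub>b\<close> before step \<open>k'\<close>, and cannot still be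
  holding a student below \<open>x\<^sub>b\<close>.
\<close>

lemma last_interrupters_removed:
  fixes I :: "('a, 'b) assignment_instance" and X :: "('a \<times> 'b) set"
  defines "M \<equiv> gs_output I"
  defines "J \<equiv> I\<lparr>edges := edges I - X\<rparr>"
  assumes inst: "stable_assignment_instance I"
    and stuck: "\<And>a b. \<not> removable J M a b"
    and consent: "\<And>h b a. (h, b) \<in> X \<inter> edges I \<Longrightarrow> (a, b) \<in> envy J M \<Longrightarrow> h \<in> C"
    and last: "\<And>w. consenting_pairs C I w \<noteq> {} \<Longrightarrow> w \<le> k'"
  shows "consenting_pairs C I k' \<subseteq> X"
proof -
  have instJ: "stable_assignment_instance J" unfolding J_def by (rule instance_delete_edges[OF inst])
  have envJ: "envy J M = envy I M - X" unfolding J_def by (rule envy_delete)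
  have lt: "lt_school J = lt_school I" by (simp add: J_def)
  have envI: "envy I M = (\<Union>k. gs_refused I k)" unfolding M_def by (rule envy_gs_output[OF inst])
  have stM: "stable I M" unfolding M_def by (rule gs_output_stable[OF inst])
  then have asgM: "assignment I M" by (simp add: stable_def)
  have MI: "M \<subseteq> edges I" using asgM by (simp add: assignment_def)
  have finM: "finite (M\<inverse> `` {b})" for b
    by (intro finite_students_of finite_subset[OF MI] instance_finite_edges inst)
  have settled: "(gs_held I j)\<inverse> `` {b} = M\<inverse> `` {b}"
    if s: "is_s J M b x" and r: "(x, b) \<in> gs_refused I j" and j: "k' \<le> j" for b x j
  proof -
    have "(h, b) \<in> M" if h: "(h, b) \<in> gs_held I j" for h
    proof (rule ccontr)
      assume nM: "(h, b) \<notin> M"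
      then obtain m where m: "(h, b) \<in> gs_refused I m"
        using gs_applied_not_output_refused[OF inst, of h b j] gs_held_applied[OF inst, of j] h
        by (auto simp: M_def)
      then have hI: "(h, b) \<in> envy I M" using envI by blast
      have xI: "(x, b) \<in> envy I M" using s envJ by (simp add: is_s_iff)
      have "lt_school I b x h" by (rule gs_refused_worse[OF inst r h])
      \<comment> \<open>\<open>b\<close> ranks \<open>h\<close> above \<open>x\<close>, the best
        envious student left in \<open>J\<close>; so \<open>(h, b)\<close> has been deleted, and
        \<open>consent\<close> applies because \<open>b\<close> is still envied.\<close>
      then have "(h, b) \<notin> envy J M"
        using s hI xI envy_subset[of I M] school_irrefl[OF inst, of x b] school_asym[OF inst, of x b h]
        unfolding is_s_iff lt by blast
      then have "h \<in> C" using consent[of h b x] hI envJ envy_subset[of I M] s by (auto simp: is_s_iff)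
      moreover obtain w where "j < w" "(h, b) \<in> interrupting_pairs I w"
        using refused_later_interrupting[OF inst r h m] by blast
      ultimately have "consenting_pairs C I w \<noteq> {}" by (auto simp: consenting_pairs_def)
      then show False using last \<open>j < w\<close> j by fastforce
    qed
    then have "(gs_held I j)\<inverse> `` {b} \<subseteq> M\<inverse> `` {b}" by blast
    moreover have "card (M\<inverse> `` {b}) \<le> card ((gs_held I j)\<inverse> `` {b})"
      using gs_refused_full[OF inst r] assignment_card_le[OF inst asgM, of b] by simp
    ultimately show ?thesis using card_seteq[OF finM] by blast
  qed
  define T where "T = {t. \<exists>b x. is_s J M b x \<and> (x, b) \<in> gs_rejected I t}"
  have "finite T"
  proof -
    obtain n where n: "gs_applications I (gs I n) = {}"
      using gs_terminates[OF instance_finite_edges[OF inst]] by blast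
    have "T \<subseteq> {..n}"
      using gs_rejected_bound[OF instance_finite_edges[OF inst] n] unfolding T_def
      by (auto simp: not_less[symmetric])
    then show ?thesis using finite_subset by blast
  qed
  have early: "t < k'" if "t \<in> T" for t
  proof (rule ccontr)
    assume "\<not> t < k'"
    define m where "m = Max T"
    have m: "m \<in> T" "k' \<le> m"
      unfolding m_def using Max_in[OF \<open>finite T\<close>] Max_ge[OF \<open>finite T\<close> that] that \<open>\<not> t < k'\<close> by auto
    obtain b x where s: "is_s J M b x" and r: "(x, b) \<in> gs_rejected I m"
      using m(1) by (auto simp: T_def)
    obtain c y where c: "(x, c) \<in> M" "(y, c) \<in> envy J M"
      using stuck[of x b] s by (auto simp: removable_def)
    obtain z where z: "is_s J M c z" using is_s_exists[OF instJ c(2)] by blast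
    then obtain i where "(z, c) \<in> gs_refused I i" using envI envJ by (auto simp: is_s_iff)
    then obtain t' where t': "(z, c) \<in> gs_rejected I t'" using gs_refusedE[OF inst] by blast
    then have "t' \<le> m" unfolding m_def using z by (intro Max_ge[OF \<open>finite T\<close>]) (auto simp: T_def)
    then have "(z, c) \<in> gs_refused I m"
      using t' gs_rejected_refused[OF inst] gs_refused_mono[OF inst] by blast
    then have "(x, c) \<in> gs_held I m" using settled[OF z _ m(2)] c(1) by blast
    then show False using gs_rejected_not_held[OF inst r] by blast
  qed
  show ?thesis
  proof (rule ccontr)
    assume "\<not> ?thesis"
    then obtain a b where ab: "(a, b) \<in> consenting_pairs C I k'" "(a, b) \<notin> X" by auto
    then have "(a, b) \<in> envy J M" using consenting_pairs_envy[OF inst] envJ M_def by blast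
    then obtain x where x: "is_s J M b x" using is_s_exists[OF instJ] by blast
    then obtain i where "(x, b) \<in> gs_refused I i" using envI envJ by (auto simp: is_s_iff)
    then obtain t where t: "(x, b) \<in> gs_rejected I t" using gs_refusedE[OF inst] by blast
    then have "t < k'" using early x by (auto simp: T_def)
    then obtain i where i: "k' = Suc i" "t \<le> i" by (cases k') auto
    have xi: "(x, b) \<in> gs_refused I i"
      using t i gs_rejected_refused[OF inst, of t] gs_refused_mono[OF inst, of t i] by blast
    have rej: "(a, b) \<in> gs_rejected I k'" and "\<exists>k<k'. (a, b) \<in> gs_held I k"
      using ab(1) by (auto simp: consenting_pairs_def interrupting_pairs_def)
    \<comment> \<open>Having applied by step \<open>i\<close> and being rejected only at
      \<open>Suc i\<close>, \<open>a\<close> is still held at step \<open>i\<close>, when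
      \<open>x\<close> has been refused.\<close>
    then obtain k where k: "k \<le> i" "(a, b) \<in> gs_held I k" using i(1) by (auto simp: less_Suc_eq_le)
    then have "(a, b) \<in> fst (gs I i)"
      using gs_held_applied[OF inst, of k] gs_applied_mono[of k i I] by blast
    moreover have "(a, b) \<notin> gs_refused I i"
      using rej unfolding i(1) gs_rejected_Suc[OF inst] by blast
    ultimately have "(a, b) \<in> gs_held I i" by (simp add: gs_refused_def)
    then have "lt_school I b x a" by (rule gs_refused_worse[OF inst xi])
    moreover have "x = a \<or> lt_school I b a x"
      using x \<open>(a, b) \<in> envy J M\<close> unfolding is_s_iff lt by blast
    moreover have "(a, b) \<in> edges I" "(x, b) \<in> edges I"
      using \<open>(a, b) \<in> envy J M\<close> x envJ envy_subset[of I M] by (auto simp: is_s_iff)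
    ultimately show False using school_irrefl[OF inst, of a b] school_asym[OF inst, of x b a] by blast
  qed
qed

text \<open>
  The second run replays the first one after the deletion of \<open>S\<close>, skipping the removals of pairs
  in \<open>S\<close>.
\<close>

lemma exhaustive_removal:
  assumes inst: "stable_assignment_instance I" and M: "stable I M" and S: "\<And>a b. (a, b) \<in> S \<Longrightarrow> a \<in> C"
  obtains X where "(srr_step C)\<^sup>*\<^sup>* (I, M) (I\<lparr>edges := edges I - X\<rparr>, M)"
    and "(srr_step C)\<^sup>*\<^sup>* (I\<lparr>edges := edges I - S\<rparr>, M) (I\<lparr>edges := edges I - (S \<union> X)\<rparr>, M)"
    and "\<forall>a b. \<not> removable (I\<lparr>edges := edges I - X\<rparr>) M a b"
    and "\<forall>h b a. (h, b) \<in> X \<inter> edges I \<longrightarrow> (a, b) \<in> envy (I\<lparr>edges := edges I - X\<rparr>) M \<longrightarrow> h \<in> C"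
proof -
  let ?del = "\<lambda>X. I\<lparr>edges := edges I - X\<rparr>"
  \<comment> \<open>The invariant of a sequence of removals that has deleted \<open>X\<close>. The
    last clause supplies the \<open>consent\<close> hypothesis of
    \<open>last_interrupters_removed\<close>.\<close>
  define P where "P X \<longleftrightarrow> (srr_step C)\<^sup>*\<^sup>* (I, M) (?del X, M) \<and>
    (srr_step C)\<^sup>*\<^sup>* (?del S, M) (?del (S \<union> X), M) \<and> M \<inter> X = {} \<and>
    (\<forall>h b a. (h, b) \<in> X \<inter> edges I \<longrightarrow> (a, b) \<in> envy (?del X) M \<longrightarrow> h \<in> C)" for X
  have "P {}" by (simp add: P_def)
  \<comment> \<open>With the fewest edges remaining, \<open>X\<close> cannot be extended by another
    removal.\<close>
  then obtain X where X: "P X" and min: "\<And>Y. P Y \<Longrightarrow> card (edges I - X) \<le> card (edges I - Y)"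
    using ex_has_least_nat[of P "{}" "\<lambda>X. card (edges I - X)"] by blast
  have "\<not> removable (?del X) M a b" for a b
  proof
    assume rem: "removable (?del X) M a b"
    let ?R = "removed_edges C I a b"
    have instX: "stable_assignment_instance (?del X)" by (rule instance_delete_edges[OF inst])
    have MX: "stable (?del X) M" using stable_delete_edges[OF M] X by (simp add: P_def)
    have s: "is_s (?del X) M b a" using rem by (simp add: removable_def)
    have "srr_step C (?del X, M) (?del (X \<union> ?R), M)"
      using removable_step[OF rem, of C] unfolding delete_delete removed_edges_delete .
    then have "(srr_step C)\<^sup>*\<^sup>* (I, M) (?del (X \<union> ?R), M)"
      using X unfolding P_def by (meson rtranclp.rtrancl_into_rtrancl)
    moreover have "(srr_step C)\<^sup>*\<^sup>* (?del S, M) (?del (S \<union> (X \<union> ?R)), M)"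
    proof (cases "(a, b) \<in> S")
      case True
      \<comment> \<open>Students in \<open>S\<close> consent, so this removal takes a single edge,
        which the second run is missing already; that run stands still.\<close>
      then have "?R = {(a, b)}" using S by (simp add: removed_edges_def)
      then have "S \<union> (X \<union> ?R) = S \<union> X" using True by auto
      then show ?thesis using X by (simp add: P_def)
    next
      case False
      have "removable (?del (S \<union> X)) M a b"
        using removable_delete[OF rem False] unfolding delete_delete by (simp add: Un_commute)
      from removable_step[OF this, of C]
      have "srr_step C (?del (S \<union> X), M) (?del (S \<union> X \<union> ?R), M)"
        unfolding delete_delete removed_edges_delete .
      then show ?thesis
        using X unfolding P_def Un_assoc by (meson rtranclp.rtrancl_into_rtrancl)
    qed
    moreover have "M \<inter> (X \<union> ?R) = {}"
      using removed_edges_disjoint[OF instX MX s, of C] X by (auto simp: P_def)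
    moreover have "h \<in> C"
      if h: "(h, c) \<in> (X \<union> ?R) \<inter> edges I" and y: "(y, c) \<in> envy (?del (X \<union> ?R)) M" for h c y
    proof -
      have y': "(y, c) \<in> envy (?del X) M" "(y, c) \<notin> ?R" using y by (auto simp: envy_delete)
      show ?thesis
      proof (cases "(h, c) \<in> X")
        case True
        then show ?thesis using X h y'(1) unfolding P_def by blast
      next
        case False
        then have hR: "(h, c) \<in> ?R" using h by blast
        then have c: "c = b" by (rule removed_edges_school)
        show ?thesis
        proof (cases "a \<in> C")
          case True
          then show ?thesis using hR by (simp add: removed_edges_def)
        next
          case False
          \<comment> \<open>As \<open>a\<close> is the best envious student at \<open>b\<close>, a
            removal without consent wipes out all envy for \<open>b\<close>, and the clause becomes
            vacuous there.\<close>
          have "y = a \<or> lt_school I b y a" using s y'(1) c by (auto simp: is_s_iff)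
          then show ?thesis using y'(2) c False by (auto simp: removed_edges_def)
        qed
      qed
    qed
    ultimately have "P (X \<union> ?R)" unfolding P_def by blast
    moreover have "card (edges I - (X \<union> ?R)) < card (edges I - X)"
    proof (rule psubset_card_mono)
      show "finite (edges I - X)" using instance_finite_edges[OF inst] by simp
      have "(a, b) \<in> edges I - X" using s envy_subset[of "?del X" M] by (auto simp: is_s_iff)
      then show "edges I - (X \<union> ?R) \<subset> edges I - X" using removed_edges_self[of a b C I] by blast
    qed
    ultimately show False using min[of "X \<union> ?R"] by simp
  qed
  then show ?thesis using that[of X] X unfolding P_def by blast
qed

lemma eadam_step_results:
  assumes inst: "stable_assignment_instance I" and cont: "eadam_continue C I"
  shows "srr_results C (eadam_step C I, gs_output (eadam_step C I)) = srr_results C (I, gs_output I)"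
proof -
  define k where "k = Max {k'. consenting_pairs C I k' \<noteq> {}}"
  define S where "S = consenting_pairs C I k"
  let ?M = "gs_output I" and ?J = "I\<lparr>edges := edges I - S\<rparr>"
  have J: "eadam_step C I = ?J" by (simp add: eadam_step_def S_def k_def)
  have M: "stable I ?M" by (rule gs_output_stable[OF inst])
  have "?M \<inter> S = {}"
    using consenting_pairs_envy[OF inst, of C k] by (auto simp: S_def envy_def)
  then have MJ: "stable ?J ?M" by (rule stable_delete_edges[OF M])
  have instJ: "stable_assignment_instance ?J" by (rule instance_delete_edges[OF inst])
  have SC: "\<And>a b. (a, b) \<in> S \<Longrightarrow> a \<in> C" by (auto simp: S_def consenting_pairs_def)
  obtain X where X: "(srr_step C)\<^sup>*\<^sup>* (I, ?M) (I\<lparr>edges := edges I - X\<rparr>, ?M)"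
    "(srr_step C)\<^sup>*\<^sup>* (?J, ?M) (I\<lparr>edges := edges I - (S \<union> X)\<rparr>, ?M)"
    and stuck: "\<forall>a b. \<not> removable (I\<lparr>edges := edges I - X\<rparr>) ?M a b"
    and consent: "\<forall>h b a. (h, b) \<in> X \<inter> edges I \<longrightarrow>
      (a, b) \<in> envy (I\<lparr>edges := edges I - X\<rparr>) ?M \<longrightarrow> h \<in> C"
    using exhaustive_removal[OF inst M SC] .
  have last: "w \<le> k" if "consenting_pairs C I w \<noteq> {}" for w
    unfolding k_def
    by (rule Max_ge[OF finite_interrupting_steps[OF instance_finite_edges[OF inst]]]) (use that in simp)
  have "S \<subseteq> X"
    unfolding S_def
  proof (rule last_interrupters_removed[OF inst])
    show "\<not> removable (I\<lparr>edges := edges I - X\<rparr>) ?M a b" for a b using stuck by blast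
    show "h \<in> C" if "(h, b) \<in> X \<inter> edges I" "(a, b) \<in> envy (I\<lparr>edges := edges I - X\<rparr>) ?M" for h b a
      using consent that by blast
  qed (rule last)
  then have "S \<union> X = X" by blast
  then have "srr_results C (I, ?M) = srr_results C (?J, ?M)"
    using srr_results_steps[OF _ X(1)] srr_results_steps[OF _ X(2)] inst instJ M MJ
    by (simp add: srr_state_def)
  also have "\<dots> = srr_results C (?J, gs_output ?J)"
    using srr_results_steps[OF _ srr_reaches_optimal[OF instJ MJ]] instJ MJ by (simp add: srr_state_def)
  finally show ?thesis by (simp add: J)
qed

section \<open>Runs without consenting interrupters\<close>

text \<open>A student of a pair in \<open>S\<close> held while the school turns someone away is
  refused there later, hence would be a consenting interrupter. So the classical blocking argument
  never meets a deleted pair.\<close>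

lemma no_interrupters_optimal:
  assumes inst: "stable_assignment_instance I" and stop: "\<not> eadam_continue C I"
    and S: "S \<subseteq> envy I (gs_output I)" and SC: "\<And>a b. (a, b) \<in> S \<Longrightarrow> a \<in> C"
  shows "student_optimal_stable (I\<lparr>edges := edges I - S\<rparr>) (gs_output I)"
proof -
  have "gs_output I \<inter> S = {}" using S by (auto simp: envy_def)
  then have "stable (I\<lparr>edges := edges I - S\<rparr>) (gs_output I)"
    by (rule stable_delete_edges[OF gs_output_stable[OF inst]])
  moreover have "(a, b) \<notin> S" if r: "(x, b) \<in> gs_rejected I j" and h: "(a, b) \<in> gs_held I j" for j x a b
  proof
    assume aS: "(a, b) \<in> S"
    then obtain m where "(a, b) \<in> gs_refused I m" using S envy_gs_output[OF inst] by blast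
    then obtain w where "(a, b) \<in> interrupting_pairs I w"
      using refused_later_interrupting[OF inst _ h] r gs_rejected_refused[OF inst] by blast
    then show False using stop SC[OF aS] by (auto simp: eadam_continue_def consenting_pairs_def)
  qed
  ultimately show ?thesis
    unfolding student_optimal_stable_def using gs_output_dominates[OF inst, of S] by force
qed

text \<open>Quantifying over all deletable sets \<open>S\<close> makes the absence of rotations inductive.\<close>

definition rotation_free ::
    "'a set \<Rightarrow> ('a, 'b) assignment_instance \<Rightarrow> ('a \<times> 'b) set \<Rightarrow> bool" where
  "rotation_free C I M \<longleftrightarrow>
     (\<forall>S \<rho>. S \<subseteq> envy I M \<longrightarrow> fst ` S \<subseteq> C \<longrightarrow> \<not> school_rotation (I\<lparr>edges := edges I - S\<rparr>) M \<rho>)"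

text \<open>With consent, the removed edge joins the deletable set. Without it, all envy for
  \<open>b\<close> disappears, so no rotation uses \<open>b\<close>, and the other schools point
  where they did before.\<close>

lemma rotation_free_remove:
  assumes free: "rotation_free C I M" and rem: "removable I M a b"
  shows "rotation_free C (I\<lparr>edges := edges I - removed_edges C I a b\<rparr>) M"
  unfolding rotation_free_def delete_delete envy_delete
proof (intro allI impI)
  fix S \<rho>
  assume S: "S \<subseteq> envy I M - removed_edges C I a b" "fst ` S \<subseteq> C"
  let ?R = "removed_edges C I a b"
  have s: "is_s I M b a" using rem by (simp add: removable_def)
  show "\<not> school_rotation (I\<lparr>edges := edges I - (?R \<union> S)\<rparr>) M \<rho>"
  proof (cases "a \<in> C")
    case True
    then have "?R \<union> S \<subseteq> envy I M" "fst ` (?R \<union> S) \<subseteq> C"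
      using S s by (auto simp: removed_edges_def is_s_iff)
    then show ?thesis using free unfolding rotation_free_def by blast
  next
    case False
    have "envy I M - (?R \<union> S) \<subseteq> {(x, c). c \<noteq> b}"
      using s False by (auto simp: removed_edges_def is_s_iff)
    moreover have "?R \<subseteq> {(x, c). c = b}" using removed_edges_school by fast
    ultimately have "is_s (I\<lparr>edges := edges I - (?R \<union> S)\<rparr>) M d x \<Longrightarrow>
        is_s (I\<lparr>edges := edges I - S\<rparr>) M d x" for d x
      by (simp add: is_s_iff envy_delete) blast
    then have "school_rotation (I\<lparr>edges := edges I - (?R \<union> S)\<rparr>) M \<rho> \<Longrightarrow>
        school_rotation (I\<lparr>edges := edges I - S\<rparr>) M \<rho>"
      by (auto simp: school_rotation_iff)
    then show ?thesis using free S unfolding rotation_free_def by blast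
  qed
qed

lemma no_interrupters_results:
  assumes inst: "stable_assignment_instance I" and stop: "\<not> eadam_continue C I"
  shows "srr_results C (I, gs_output I) = {gs_output I}"
proof -
  let ?M = "gs_output I"
  have free: "rotation_free C I ?M"
    unfolding rotation_free_def
  proof (intro allI impI)
    fix S \<rho> assume "S \<subseteq> envy I ?M" "fst ` S \<subseteq> C"
    then have "student_optimal_stable (I\<lparr>edges := edges I - S\<rparr>) ?M"
      by (intro no_interrupters_optimal[OF inst stop]) force+
    then show "\<not> school_rotation (I\<lparr>edges := edges I - S\<rparr>) ?M \<rho>"
      by (rule student_optimal_no_rotation[OF instance_delete_edges[OF inst]])
  qed
  have state: "srr_state (I, ?M)"
    using inst gs_output_stable[OF inst] by (simp add: srr_state_def)
  have stay: "snd t = ?M \<and> rotation_free C (fst t) ?M"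
    if "(srr_step C)\<^sup>*\<^sup>* (I, ?M) t" for t
    using that
  proof (induction rule: rtranclp_induct)
    case (step t u)
    obtain K where t: "t = (K, ?M)" and freeK: "rotation_free C K ?M" using step by (cases t) auto
    have "srr_state (K, ?M)" using srr_steps_state[OF step.hyps(1) state] by (simp add: t)
    then have K: "stable_assignment_instance K" "assignment K ?M"
      by (auto simp: srr_state_def stable_def)
    from K step.hyps(2)[unfolded t] show ?case
    proof (cases rule: srr_stepE)
      case (remove a b)
      then show ?thesis using rotation_free_remove[OF freeK] by simp
    next
      case (rotate \<rho>)
      moreover have "\<not> school_rotation K ?M \<rho>"
        using freeK[unfolded rotation_free_def, rule_format, of "{}"] by simp
      ultimately show ?thesis by blast
    qed
  qed (simp add: free)
  then have "srr_results C (I, ?M) \<subseteq> {?M}" unfolding srr_results_def by force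
  \<comment> \<open>The inclusion alone would hold if no run ended; termination provides a
    result.\<close>
  then show ?thesis using srr_results_nonempty[OF state, of C] by blast
qed

lemma srr_results_eadam:
  assumes "stable_assignment_instance I"
  shows "srr_results C (I, gs_output I) = {eadam C I}"
proof -
  obtain J where J: "while_option (eadam_continue C) (eadam_step C) I = Some J"
    using eadam_terminates[OF instance_finite_edges[OF assms]] by blast
  have "stable_assignment_instance J \<and>
      srr_results C (J, gs_output J) = srr_results C (I, gs_output I)"
  proof (rule while_option_rule[OF _ J, where P = "\<lambda>J. stable_assignment_instance J \<and>
      srr_results C (J, gs_output J) = srr_results C (I, gs_output I)"])
    fix K assume K: "stable_assignment_instance K \<and>
        srr_results C (K, gs_output K) = srr_results C (I, gs_output I)" "eadam_continue C K"
    then show "stable_assignment_instance (eadam_step C K) \<and>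
        srr_results C (eadam_step C K, gs_output (eadam_step C K)) = srr_results C (I, gs_output I)"
      using eadam_step_results instance_delete_edges unfolding eadam_step_def by metis
  qed (use assms in simp)
  moreover have "\<not> eadam_continue C J" by (rule while_option_stop[OF J])
  ultimately show ?thesis
    using no_interrupters_results[of J C] J by (simp add: eadam_def while_def)
qed

theorem theorem10:
  fixes I :: "('a, 'b) assignment_instance" and C :: "'a set"
  assumes "stable_assignment_instance I" and "C \<subseteq> students I"
  shows "srr_terminates C I \<and> (\<forall>M. srr_output C I M \<longleftrightarrow> M = eadam C I)"
proof
  \<comment> \<open>The algorithm is given its start by a property; uniqueness pins it to the
    Gale--Shapley output.\<close>
  have start: "student_optimal_stable I M0 \<longleftrightarrow> M0 = gs_output I" for M0
    using gs_output_optimal[OF assms(1)] student_optimal_stable_unique[OF assms(1)] by blast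
  have reach: "srr_reachable C I s \<longleftrightarrow> (srr_step C)\<^sup>*\<^sup>* (I, gs_output I) s" for s
    by (simp add: srr_reachable_def start)
  have state: "srr_state s" if "srr_reachable C I s" for s
    using srr_steps_state[of C "(I, gs_output I)" s] that assms(1) gs_output_stable[OF assms(1)]
    by (simp add: reach srr_state_def)
  show "srr_terminates C I"
    unfolding srr_terminates_def
  proof (intro conjI allI impI notI)
    fix J M assume "srr_reachable C I (J, M) \<and> school_rotation_digraph J M \<noteq> {}"
    then show "\<exists>S'. srr_step C (J, M) S'" using srr_progress state by blast
  next
    assume "\<exists>f. srr_reachable C I (f 0) \<and> (\<forall>i::nat. srr_step C (f i) (f (Suc i)))"
    then obtain f where f0: "srr_reachable C I (f 0)"
      and f: "\<And>i::nat. srr_step C (f i) (f (Suc i))" by blast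
    have "srr_reachable C I (f i)" for i
    proof (induction i)
      case (Suc i)
      then show ?case using f[of i] unfolding reach by (rule rtranclp.rtrancl_into_rtrancl)
    qed (rule f0)
    then have "(f (Suc i), f i) \<in> measure srr_size" for i
      using srr_step_size[OF state f] by simp
    moreover have "wf (measure srr_size)" by simp
    ultimately show False unfolding wf_iff_no_infinite_down_chain by blast
  qed
  show "\<forall>M. srr_output C I M \<longleftrightarrow> M = eadam C I"
    using srr_results_eadam[OF assms(1), of C] by (auto simp: srr_output_def reach srr_results_def)
qed

end
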